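(* Let $\alpha>0$, $\sigma_0>0$, $\beta>0$, $C_1>0$, $C_2>0$, $\gamma\in(0,\alpha)$, and let $F$ be a c.d.f. with $F(0)=0$ and $F(x)=\exp\{-\sigma^\alpha(x)x^{-\alpha}\}$ for $x>0$, where $\sigma:(0,\infty)\to(0,\infty]$ satisfies $\sigma(x)\to\sigma_0$ as $x\to\infty$, $|\sigma^\alpha(x)-\sigma_0^\alpha|\le C_1x^{-\beta}$ for all sufficiently large $x$, and $\sigma^\alpha(x)\ge C_2\min\{1,x^\gamma\}$ for all $x>0$. Let $X(1),X(2),\dots$ be i.i.d. with c.d.f. $F$, let $M_n:=n^{-1/\alpha}\max_{1\le i\le n}X(i)$ with c.d.f. $F_n$, and let $Z$ be a random variable with c.d.f. $G(x)=\exp\{-\sigma_0^\alpha x^{-\alpha}\}$, $x>0$ ($G(x)=0$ for $x\le 0$). Let $f:(0,\infty)\to\mathbb{R}$ be absolutely continuous on every compact interval $[a,b]\subset(0,\infty)$, i.e. $f(x)=f(x_0)+\int_{x_0}^xf'(u)\,du$ for all $x,x_0>0$, with $f'$ locally integrable on $(0,\infty)$. (a) Suppose that for some $m\in\mathbb{R}$ and $\delta>0$, $$x^m|f(x)|+\operatorname*{ess\,sup}_{0<y\le x}y^m|f'(y)|\to0\quad (x\downarrow0),\qquad x^{-\alpha}|f(x)|+x^{1+\delta}\operatorname*{ess\,sup}_{y\ge x}y^{-\alpha}|f'(y)|\to0\quad (x\to\infty).$$ Then $\mathbb{E}|f(Z)|<\infty$ and $\mathbb{E}|f(M_n)|<\infty$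 for all $n\in\mathbb{N}$, and $$\mathbb{E}f(M_n)-\mathbb{E}f(Z)=\int_0^\infty(G(x)-F_n(x))f'(x)\,dx.$$ (b) Suppose in addition that $\int_1^\infty x^{-(\alpha+\beta)}|f'(x)|\,dx<\infty$. Then for any sequence $\epsilon(n)>0$ with $\epsilon(n)\to0$ and $n^{1/\alpha}\epsilon(n)\to\infty$ as $n\to\infty$, and for any $c\in(0,\sigma_0^\alpha)$, we have for all sufficiently large $n$ $$|\mathbb{E}f(M_n)-\mathbb{E}f(Z)|\le C_1n^{-\beta/\alpha}\int_0^\infty x^{-(\alpha+\beta)}|f'(x)|e^{-cx^{-\alpha}}\,dx+2\int_0^{\epsilon(n)}e^{-C_2x^{-(\alpha-\gamma)}}|f'(x)|\,dx.$$ Moreover, there is a constant $C_f>0$ such that $|\mathbb{E}f(M_n)-\mathbb{E}f(Z)|\le C_fn^{-\beta/\alpha}$ for all sufficiently large $n$.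
   Context: Convention: if $\sigma(x)=\infty$ then $F(x)=e^{-\infty}=0$. The essential supremum is taken with respect to Lebesgue measure. *)

theory Defs
  imports "HOL-Probability.Probability"
begin

text \<open>
  The power \<open>s\<^sup>a\<close> for \<open>s \<in> (0,\<infinity>]\<close> and \<open>a > 0\<close>, so \<open>\<infinity>\<^sup>a = \<infinity>\<close>; other arguments are irrelevant.
\<close>
definition ereal_powr :: "ereal \<Rightarrow> real \<Rightarrow> ereal" where
  "ereal_powr s a = (if s = \<infinity> then \<infinity> else ereal (real_of_ereal s powr a))"

definition frechet_cdf :: "real \<Rightarrow> real \<Rightarrow> real \<Rightarrow> real" where
  "frechet_cdf \<alpha> \<sigma>\<^sub>0 x = (if 0 < x then exp (- (\<sigma>\<^sub>0 powr \<alpha>) * x powr (- \<alpha>)) else 0)"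

text \<open>Sequences of random variables are indexed from 1; \<open>X 0\<close> is never used.\<close>
definition normalized_max :: "real \<Rightarrow> (nat \<Rightarrow> 'a \<Rightarrow> real) \<Rightarrow> nat \<Rightarrow> 'a \<Rightarrow> real" where
  "normalized_max \<alpha> X n \<omega> = real n powr (- 1 / \<alpha>) * Max ((\<lambda>i. X i \<omega>) ` {1..n})"

definition normalized_max_cdf :: "'a measure \<Rightarrow> real \<Rightarrow> (nat \<Rightarrow> 'a \<Rightarrow> real) \<Rightarrow> nat \<Rightarrow> real \<Rightarrow> real" where
  "normalized_max_cdf P \<alpha> X n = cdf (distr P borel (normalized_max \<alpha> X n))"

text \<open>
  \<open>f\<close> is absolutely continuous on the compact subintervals of \<open>(0,\<infinity>)\<close> with a.e. derivative \<open>f'\<close>.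
  The interval integral is oriented. Integrals are over \<^const>\<open>lebesgue\<close> (the completion of
  \<^const>\<open>lborel\<close>), so that \<open>f'\<close> need not be Borel measurable.
\<close>
definition locally_abs_cont :: "(real \<Rightarrow> real) \<Rightarrow> (real \<Rightarrow> real) \<Rightarrow> bool" where
  "locally_abs_cont f f' \<longleftrightarrow>
     (\<forall>a b. 0 < a \<and> a \<le> b \<longrightarrow> set_integrable lebesgue {a..b} f') \<and>
     (\<forall>x>0. \<forall>x\<^sub>0>0. f x = f x\<^sub>0 + (LINT u=x\<^sub>0..x|lebesgue. f' u))"

text \<open>
  \<open>E f(Y)\<close> for an almost surely positive random variable \<open>Y\<close> and a function \<open>f\<close> that is meaningful
  on \<open>(0,\<infinity>)\<close> only: the null event \<open>Y \<le> 0\<close>, where \<open>f\<close> takes arbitrary and possibly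
  non-measurable values, is discarded.
\<close>
definition pos_integrable :: "'a measure \<Rightarrow> (real \<Rightarrow> real) \<Rightarrow> ('a \<Rightarrow> real) \<Rightarrow> bool" where
  "pos_integrable P f Y \<longleftrightarrow> set_integrable P {\<omega> \<in> space P. 0 < Y \<omega>} (\<lambda>\<omega>. f (Y \<omega>))"

definition pos_expectation :: "'a measure \<Rightarrow> (real \<Rightarrow> real) \<Rightarrow> ('a \<Rightarrow> real) \<Rightarrow> real" where
  "pos_expectation P f Y = (LINT \<omega>:{\<omega> \<in> space P. 0 < Y \<omega>}|P. f (Y \<omega>))"

end

theory Submission
  imports Defs "HOL-Real_Asymp.Real_Asymp"
begin

text \<open>
  Writing \<open>f(Y) - f(1)\<close> as the integral of \<open>f'(y) (1[y \<ge> 1] - 1[Y \<le> y])\<close> over \<open>y > 0\<close> and applying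
  Fubini gives \<open>E f(Y) = f(1) + \<integral> f'(y) (1[y \<ge> 1] - H(y)) dy\<close> for every positive random variable \<open>Y\<close>
  with distribution function \<open>H\<close>; part (a) is the difference of two such formulas. They converge
  because \<open>|f'|\<close> is at most \<open>y\<^sup>-\<^sup>m\<close> near \<open>0\<close>, where \<open>H\<close> decays like \<open>exp(-k y\<^sup>-\<^sup>\<kappa>)\<close>, and of order
  \<open>y\<^sup>\<alpha>\<^sup>-\<^sup>1\<^sup>-\<^sup>\<delta>\<close> at infinity, where \<open>1 - H\<close> is of order \<open>y\<^sup>-\<^sup>\<alpha>\<close>.

  For part (b), \<open>F\<^sub>n(x) = F(n\<^sup>1\<^sup>/\<^sup>\<alpha> x)\<^sup>n\<close> has the Frechet form with \<open>\<sigma>(n\<^sup>1\<^sup>/\<^sup>\<alpha> x)\<close> in place of \<open>\<sigma>\<^sub>0\<close>. For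
  \<open>x \<ge> \<epsilon>(n)\<close> the argument \<open>n\<^sup>1\<^sup>/\<^sup>\<alpha> x\<close> is large, so the rate of \<open>\<sigma>\<close> and the mean value bound for \<open>exp\<close>
  apply; for \<open>x < \<epsilon>(n)\<close> both distribution functions are below \<open>exp(-C\<^sub>2 x\<^sup>-\<^sup>(\<^sup>\<alpha>\<^sup>-\<^sup>\<gamma>\<^sup>))\<close>. The final rate
  follows with \<open>\<epsilon>(n) = n\<^sup>-\<^sup>1\<^sup>/\<^sup>(\<^sup>2\<^sup>\<alpha>\<^sup>)\<close>.
\<close>

section \<open>Reduction from Lebesgue to Borel measurability\<close>

lemma lebesgue_borel_transfer:
  fixes u v :: "real \<Rightarrow> real"
  assumes u: "u \<in> borel_measurable lebesgue" and v: "v \<in> borel_measurable borel"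
    and eq: "AE x in lborel. u x = v x"
  shows "integrable lebesgue u \<longleftrightarrow> integrable lborel v"
    and "integral\<^sup>L lebesgue u = integral\<^sup>L lborel v"
proof -
  have v': "v \<in> borel_measurable lebesgue"
    using v by (auto intro: measurable_completion)
  have eq': "AE x in lebesgue. u x = v x"
    using eq by (rule AE_completion)
  have "integrable lebesgue u \<longleftrightarrow> integrable lebesgue v"
    by (rule integrable_cong_AE[OF u v' eq'])
  then show "integrable lebesgue u \<longleftrightarrow> integrable lborel v"
    using v by (simp add: integrable_completion)
  have "integral\<^sup>L lebesgue u = integral\<^sup>L lebesgue v"
    by (rule integral_cong_AE[OF u v' eq'])
  then show "integral\<^sup>L lebesgue u = integral\<^sup>L lborel v"
    using v by (simp add: integral_completion)
qed

text \<open>The free integrand \<open>\<Phi>\<close> lets one transfer serve \<open>f'\<close>, its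
  absolute value and every weighted integrand below. Measurability of \<open>f'\<close> is known on
  the positive half-line alone, so an indicator is inserted under \<open>\<Phi>\<close> and removed
  again on \<open>A\<close>.\<close>

lemma set_lebesgue_borel_transfer:
  fixes f' g :: "real \<Rightarrow> real" and \<Phi> :: "real \<Rightarrow> real \<Rightarrow> real"
  assumes f': "(\<lambda>x. indicator {0<..} x * f' x) \<in> borel_measurable lebesgue"
    and g[measurable]: "g \<in> borel_measurable borel"
    and eq: "AE x in lborel. 0 < x \<longrightarrow> f' x = g x"
    and A: "A \<in> sets borel" "A \<subseteq> {0<..}"
    and \<Phi>[measurable]: "(\<lambda>(x, y). \<Phi> x y) \<in> borel_measurable (borel \<Otimes>\<^sub>M borel)"
  shows "set_integrable lebesgue A (\<lambda>x. \<Phi> x (f' x)) \<longleftrightarrow> set_integrable lborel A (\<lambda>x. \<Phi> x (g x))"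
    and "(LINT x:A|lebesgue. \<Phi> x (f' x)) = (LINT x:A|lborel. \<Phi> x (g x))"
proof -
  have id: "(\<lambda>x. x) \<in> lebesgue \<rightarrow>\<^sub>M borel"
    by (rule measurable_completion) simp
  have "(\<lambda>x. \<Phi> x (indicator {0<..} x * f' x)) \<in> borel_measurable lebesgue"
    using measurable_compose[OF measurable_Pair[OF id f'] \<Phi>] by simp
  moreover have "(indicator A :: real \<Rightarrow> real) \<in> borel_measurable lebesgue"
    using A by (auto intro: measurable_completion)
  ultimately have "(\<lambda>x. indicator A x * \<Phi> x (indicator {0<..} x * f' x)) \<in> borel_measurable lebesgue"
    by measurable
  also have "(\<lambda>x. indicator A x * \<Phi> x (indicator {0<..} x * f' x)) = (\<lambda>x. indicator A x * \<Phi> x (f' x))"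
    using A(2) by (auto simp: indicator_def fun_eq_iff)
  finally have u: "(\<lambda>x. indicator A x * \<Phi> x (f' x)) \<in> borel_measurable lebesgue" .
  have v: "(\<lambda>x. indicator A x * \<Phi> x (g x)) \<in> borel_measurable borel"
    using A by measurable
  have ae: "AE x in lborel. indicator A x * \<Phi> x (f' x) = indicator A x * \<Phi> x (g x)"
    using eq by eventually_elim (use A(2) in \<open>auto simp: indicator_def\<close>)
  show "set_integrable lebesgue A (\<lambda>x. \<Phi> x (f' x)) \<longleftrightarrow> set_integrable lborel A (\<lambda>x. \<Phi> x (g x))"
    and "(LINT x:A|lebesgue. \<Phi> x (f' x)) = (LINT x:A|lborel. \<Phi> x (g x))"
    using lebesgue_borel_transfer[OF u v ae]
    by (simp_all add: set_integrable_def set_lebesgue_integral_def)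
qed

text \<open>On the positive half-line \<open>f'\<close> is the pointwise limit of its restrictions
  to [1/(n+1), n+1], which are measurable because they are integrable; a Lebesgue measurable
  function agrees a.e. with a Borel one. The Fubini argument below runs on this Borel
  version.\<close>

lemma locally_abs_cont_borel_version:
  assumes "locally_abs_cont f f'"
  obtains g where "g \<in> borel_measurable borel"
    "(\<lambda>x. indicator {0<..} x * f' x) \<in> borel_measurable lebesgue"
    "AE x in lborel. 0 < x \<longrightarrow> f' x = g x"
    "\<And>a b. 0 < a \<Longrightarrow> set_integrable lborel {a..b} g"
    "\<And>x y. 0 < x \<Longrightarrow> x \<le> y \<Longrightarrow> f y - f x = (LINT u:{x..<y}|lborel. g u)"
proof -
  have int: "set_integrable lebesgue {a..b} f'" if "0 < a" "a \<le> b" for a b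
    using assms that by (simp add: locally_abs_cont_def)
  define u where "u = (\<lambda>x. indicator {0<..} x * f' x)"
  have lim: "(\<lambda>n. indicator {1 / (real n + 1)..real n + 1} x * f' x) \<longlonglongrightarrow> u x" for x
  proof (cases "0 < x")
    case True
    have "(\<lambda>n. 1 / (real n + 1)) \<longlonglongrightarrow> 0" "filterlim (\<lambda>n. real n + 1) at_top sequentially"
      by real_asymp+
    then have "\<forall>\<^sub>F n in sequentially. 1 / (real n + 1) < x"
      "\<forall>\<^sub>F n in sequentially. x \<le> real n + 1"
      using True by (auto simp: filterlim_at_top dest: order_tendstoD(2))
    then have "\<forall>\<^sub>F n in sequentially. indicator {1 / (real n + 1)..real n + 1} x * f' x = u x"
      by eventually_elim (use True in \<open>simp add: u_def\<close>)
    then show ?thesis by (rule tendsto_eventually)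
  next
    case False
    have "\<not> 1 / (real n + 1) \<le> x" for n
    proof -
      have "0 < 1 / (real n + 1)" by simp
      then show ?thesis using False by linarith
    qed
    then show ?thesis using False by (simp add: u_def)
  qed
  have u: "u \<in> borel_measurable lebesgue"
  proof (rule borel_measurable_LIMSEQ_real[OF lim])
    fix n :: nat
    have "1 / (real n + 1) \<le> 1" "1 \<le> real n + 1" by simp_all
    then have "1 / (real n + 1) \<le> real n + 1" by linarith
    from int[OF _ this]
    show "(\<lambda>x. indicator {1 / (real n + 1)..real n + 1} x * f' x) \<in> borel_measurable lebesgue"
      by (simp add: set_integrable_def borel_measurable_integrable)
  qed
  obtain g where g: "g \<in> borel_measurable lborel" "AE x in lborel. u x = g x"
    using completion_ex_borel_measurable_real[OF u] by auto
  have eq: "AE x in lborel. 0 < x \<longrightarrow> f' x = g x"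
    using g(2) by eventually_elim (auto simp: u_def)
  have g': "g \<in> borel_measurable borel" using g by simp
  note tr = set_lebesgue_borel_transfer[OF u[unfolded u_def] g' eq, where \<Phi> = "\<lambda>x y. y", simplified]
  show thesis
  proof (rule that[OF g' _ eq])
    show "(\<lambda>x. indicator {0<..} x * f' x) \<in> borel_measurable lebesgue"
      using u by (simp add: u_def)
    show "set_integrable lborel {a..b} g" if "0 < a" for a b :: real
    proof (cases "a \<le> b")
      case True
      then show ?thesis using int[OF that True] that by (subst (asm) tr) auto
    qed (simp add: set_integrable_def)
    show "f y - f x = (LINT u:{x..<y}|lborel. g u)" if xy: "0 < x" "x \<le> y" for x y
    proof -
      have "f y = f x + (LINT u=x..y|lebesgue. f' u)"
        using assms xy less_le_trans[OF xy] unfolding locally_abs_cont_def by blast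
      moreover have "(LINT u=x..y|lebesgue. f' u) = (LINT u=x..y|lborel. g u)"
        using xy by (auto simp: interval_lebesgue_integral_def intro!: tr(2))
      ultimately show ?thesis
        using xy by (simp add: interval_integral_Ico)
    qed
  qed
qed

section \<open>Expectations in terms of the distribution function\<close>

lemma (in prob_space) pos_expectation_eq_integral:
  fixes Y :: "'a \<Rightarrow> real"
  assumes Y[measurable]: "Y \<in> borel_measurable M" and pos: "AE \<omega> in M. 0 < Y \<omega>"
    and H: "H = cdf (distr M borel Y)"
    and g[measurable]: "g \<in> borel_measurable borel"
    and f: "\<And>x y. 0 < x \<Longrightarrow> x \<le> y \<Longrightarrow> f y - f x = (LINT u:{x..<y}|lborel. g u)"
    and int: "set_integrable lborel {0<..} (\<lambda>y. (indicator {1..} y - H y) * g y)"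
  shows "pos_integrable M f Y"
    and "pos_expectation M f Y = f 1 + (LINT y:{0<..}|lborel. (indicator {1..} y - H y) * g y)"
proof -
  interpret pair_sigma_finite lborel M ..
  \<comment> \<open>The weight is the signed indicator of the interval between \<open>1\<close> and \<open>Y \<omega>\<close>,
    so that \<open>f (Y \<omega>) - f 1\<close> is the integral of \<open>k y \<omega>\<close> over \<open>y\<close>.\<close>
  define k where "k = (\<lambda>y \<omega>. indicator {0<..} y *
    (((if 1 \<le> y then 1 else 0) - (if Y \<omega> \<le> y then 1 else 0)) * g y))"
  have k_meas[measurable]: "(\<lambda>(y, \<omega>). k y \<omega>) \<in> borel_measurable (lborel \<Otimes>\<^sub>M M)"
    unfolding k_def by measurable
  have Hy: "H y = prob {\<omega> \<in> space M. Y \<omega> \<le> y}" for y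
    unfolding H cdf_def by (subst measure_distr) (auto intro!: arg_cong[where f = prob])
  have le_int: "has_bochner_integral M (\<lambda>\<omega>. if Y \<omega> \<le> y then 1 else 0 :: real) (H y)" for y
  proof -
    have "has_bochner_integral M (indicator {\<omega> \<in> space M. Y \<omega> \<le> y}) (H y)"
      unfolding Hy by (intro has_bochner_integral_real_indicator) (auto simp: emeasure_eq_measure)
    then show ?thesis
      by (subst has_bochner_integral_cong[where N = M]) (auto simp: indicator_def)
  qed
  have const: "has_bochner_integral M (\<lambda>\<omega>. c) c" for c :: real
    by (simp add: has_bochner_integral_iff prob_space)
  have inner: "has_bochner_integral M (k y)
      (indicator {0<..} y * ((indicator {1..} y - H y) * g y))" for y
    unfolding k_def using const le_int
    by (intro has_bochner_integral_mult_right has_bochner_integral_mult_left has_bochner_integral_diff)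
       (auto simp: indicator_def)
  have H01: "0 \<le> H y" "H y \<le> 1" for y
    unfolding Hy by simp_all
  \<comment> \<open>For fixed \<open>y\<close> the kernel \<open>k y\<close> keeps one sign in
    \<open>\<omega>\<close>, so its L1 norm is the absolute value of its mean. The hypothesis
    \<open>int\<close> is therefore exactly the condition for Fubini.\<close>
  have norm: "(\<integral>\<omega>. norm (k y \<omega>) \<partial>M) = \<bar>indicator {0<..} y * ((indicator {1..} y - H y) * g y)\<bar>" for y
  proof (cases "1 \<le> y")
    case True
    then have "norm (k y \<omega>) = (1 - (if Y \<omega> \<le> y then 1 else 0)) * \<bar>g y\<bar>" for \<omega>
      by (simp add: k_def abs_mult)
    then have "(\<integral>\<omega>. norm (k y \<omega>) \<partial>M) = (1 - H y) * \<bar>g y\<bar>"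
      using has_bochner_integral_mult_left[OF has_bochner_integral_diff[OF const[of 1] le_int[of y]], of "\<bar>g y\<bar>"]
      by (simp add: has_bochner_integral_iff)
    then show ?thesis using True H01[of y] by (simp add: abs_mult)
  next
    case False
    then have "norm (k y \<omega>) = (if Y \<omega> \<le> y then 1 else 0) * (indicator {0<..} y * \<bar>g y\<bar>)" for \<omega>
      by (simp add: k_def abs_mult)
    then have "(\<integral>\<omega>. norm (k y \<omega>) \<partial>M) = H y * (indicator {0<..} y * \<bar>g y\<bar>)"
      using has_bochner_integral_mult_left[OF le_int[of y], of "indicator {0<..} y * \<bar>g y\<bar>"]
      by (simp add: has_bochner_integral_iff)
    then show ?thesis using False H01[of y] by (simp add: abs_mult)
  qed
  have int': "integrable lborel (\<lambda>y. indicator {0<..} y * ((indicator {1..} y - H y) * g y))"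
    using int by (simp add: set_integrable_def)
  have k_int: "integrable (lborel \<Otimes>\<^sub>M M) (\<lambda>(y, \<omega>). k y \<omega>)"
  proof (rule Fubini_integrable)
    show "integrable lborel (\<lambda>y. \<integral>\<omega>. norm (case (y, \<omega>) of (y, \<omega>) \<Rightarrow> k y \<omega>) \<partial>M)"
      using integrable_abs[OF int'] by (simp add: norm del: real_norm_def)
    show "AE y in lborel. integrable M (\<lambda>\<omega>. case (y, \<omega>) of (y, \<omega>) \<Rightarrow> k y \<omega>)"
      using inner by (auto simp: has_bochner_integral_iff)
  qed simp
  \<comment> \<open>Both comparisons in \<open>k\<close> are weak, which leaves half-open intervals:
    [1, Y) with sign + or [Y, 1) with sign -.\<close>
  have outer: "(\<integral>y. k y \<omega> \<partial>lborel) = f (Y \<omega>) - f 1" if "0 < Y \<omega>" for \<omega>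
  proof (cases "1 \<le> Y \<omega>")
    case True
    then have "k y \<omega> = indicator {1..<Y \<omega>} y *\<^sub>R g y" for y
      by (auto simp: k_def indicator_def)
    then show ?thesis using f[of 1 "Y \<omega>"] True by (simp add: set_lebesgue_integral_def)
  next
    case False
    then have "k y \<omega> = - (indicator {Y \<omega>..<1} y *\<^sub>R g y)" for y
      using that by (auto simp: k_def indicator_def)
    then show ?thesis using f[of "Y \<omega>" 1] that False by (simp add: set_lebesgue_integral_def)
  qed
  have i1: "integrable M (\<lambda>\<omega>. \<integral>y. k y \<omega> \<partial>lborel)"
    using integrable_snd[OF k_int] .
  let ?A = "{\<omega> \<in> space M. 0 < Y \<omega>}"
  \<comment> \<open>Off \<open>?A\<close> the values of \<open>f\<close> are arbitrary; on it,
    measurability and integrability of \<open>f (Y \<omega>)\<close> are inherited from the integral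
    of \<open>k\<close>.\<close>
  have i2: "integrable M (\<lambda>\<omega>. indicator ?A \<omega> * (f 1 + (\<integral>y. k y \<omega> \<partial>lborel)))"
    using integrable_mult_indicator[of ?A M "\<lambda>\<omega>. f 1 + (\<integral>y. k y \<omega> \<partial>lborel)"] i1
    by simp
  have eq: "indicator ?A \<omega> * (f 1 + (\<integral>y. k y \<omega> \<partial>lborel)) = indicator ?A \<omega> *\<^sub>R f (Y \<omega>)" for \<omega>
    by (simp add: outer indicator_def)
  show "pos_integrable M f Y"
    using i2 unfolding pos_integrable_def set_integrable_def eq .
  have "pos_expectation M f Y = (\<integral>\<omega>. indicator ?A \<omega> * (f 1 + (\<integral>y. k y \<omega> \<partial>lborel)) \<partial>M)"
    unfolding pos_expectation_def set_lebesgue_integral_def eq ..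
  also have "\<dots> = (\<integral>\<omega>. f 1 + (\<integral>y. k y \<omega> \<partial>lborel) \<partial>M)"
  proof (rule integral_cong_AE)
    show "AE \<omega> in M. indicator ?A \<omega> * (f 1 + (\<integral>y. k y \<omega> \<partial>lborel)) = f 1 + (\<integral>y. k y \<omega> \<partial>lborel)"
      using pos AE_space by eventually_elim simp
  qed (use i1 i2 in auto)
  also have "\<dots> = f 1 + (\<integral>\<omega>. \<integral>y. k y \<omega> \<partial>lborel \<partial>M)"
    using i1 by (simp add: prob_space)
  also have "(\<integral>\<omega>. \<integral>y. k y \<omega> \<partial>lborel \<partial>M) = (\<integral>y. \<integral>\<omega>. k y \<omega> \<partial>M \<partial>lborel)"
    using Fubini_integral[OF k_int] .
  also have "\<dots> = (LINT y:{0<..}|lborel. (indicator {1..} y - H y) * g y)"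
    using inner by (simp add: has_bochner_integral_iff set_lebesgue_integral_def)
  finally show "pos_expectation M f Y = f 1 + (LINT y:{0<..}|lborel. (indicator {1..} y - H y) * g y)" .
qed

section \<open>Growth of the derivative and integrability\<close>

lemma set_integrable_powr_at_top:
  fixes R \<delta> :: real
  assumes "0 < R" "0 < \<delta>"
  shows "set_integrable lborel {R..} (\<lambda>y. y powr (- 1 - \<delta>))"
proof -
  have *: "- 1 - \<delta> = - \<delta> - 1" by simp
  have "((\<lambda>y. - (y powr (- \<delta>)) / \<delta>) \<longlongrightarrow> 0) at_top"
    using assms by real_asymp
  then have "(\<integral>\<^sup>+y. ennreal (y powr (- 1 - \<delta>)) * indicator {R..} y \<partial>lborel)
      = ennreal (0 - (- (R powr (- \<delta>)) / \<delta>))"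
    using assms unfolding *
    by (intro nn_integral_FTC_atLeast)
       (auto intro!: derivative_eq_intros simp: field_simps)
  also have "(\<lambda>y. ennreal (y powr (- 1 - \<delta>)) * indicator {R..} y)
      = (\<lambda>y. ennreal (indicator {R..} y * y powr (- 1 - \<delta>)))"
    by (auto simp: fun_eq_iff indicator_def)
  finally show ?thesis
    unfolding set_integrable_def by (intro integrableI_bounded) auto
qed

text \<open>A sum tending to 0 is below 1 at some \<open>a > 0\<close>, and its \<open>f\<close>
  term is nonnegative, so the essential supremum over (0, a] is at most 1.\<close>

lemma esssup_bound_at_0:
  fixes f f' :: "real \<Rightarrow> real" and m :: real
  assumes "((\<lambda>x. ereal (x powr m * \<bar>f x\<bar>)
        + esssup (restrict_space lebesgue {0<..x}) (\<lambda>y. ereal (y powr m * \<bar>f' y\<bar>))) \<longlongrightarrow> 0) (at_right 0)"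
  obtains a where "0 < a"
    "AE y in lborel. 0 < y \<and> y < a \<longrightarrow> \<bar>f' y\<bar> \<le> y powr (- m)"
proof -
  have "\<forall>\<^sub>F x in at_right 0. ereal (x powr m * \<bar>f x\<bar>)
        + esssup (restrict_space lebesgue {0<..x}) (\<lambda>y. ereal (y powr m * \<bar>f' y\<bar>)) < 1"
    by (rule order_tendstoD(2)[OF assms]) simp
  moreover have "\<forall>\<^sub>F x::real in at_right 0. 0 < x"
    by (rule eventually_at_right_less)
  ultimately have "\<forall>\<^sub>F x in at_right 0. 0 < x \<and> ereal (x powr m * \<bar>f x\<bar>)
        + esssup (restrict_space lebesgue {0<..x}) (\<lambda>y. ereal (y powr m * \<bar>f' y\<bar>)) < 1"
    by eventually_elim simp
  then obtain a where a: "0 < a" and *: "ereal (a powr m * \<bar>f a\<bar>)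
        + esssup (restrict_space lebesgue {0<..a}) (\<lambda>y. ereal (y powr m * \<bar>f' y\<bar>)) < 1"
    by (auto dest!: eventually_happens)
  define E where "E = esssup (restrict_space lebesgue {0<..a}) (\<lambda>y. ereal (y powr m * \<bar>f' y\<bar>))"
  have "E \<le> 1"
  proof (cases E)
    case (real r)
    have "0 \<le> a powr m * \<bar>f a\<bar>" by simp
    moreover have "a powr m * \<bar>f a\<bar> + r < 1"
      using * unfolding E_def[symmetric] real by (simp add: one_ereal_def)
    ultimately have "r \<le> 1" by linarith
    then show ?thesis using real by (simp add: one_ereal_def)
  qed (use * E_def in auto)
  have "AE y in restrict_space lebesgue {0<..a}. ereal (y powr m * \<bar>f' y\<bar>) \<le> E"
    unfolding E_def by (rule esssup_AE)
  then have "AE y in lborel. y \<in> {0<..a} \<longrightarrow> ereal (y powr m * \<bar>f' y\<bar>) \<le> E"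
    by (subst (asm) AE_restrict_space_iff) (auto simp: AE_completion_iff)
  then have "AE y in lborel. 0 < y \<and> y < a \<longrightarrow> \<bar>f' y\<bar> \<le> y powr (- m)"
  proof eventually_elim
    case (elim y)
    show ?case
    proof
      assume y: "0 < y \<and> y < a"
      have "ereal (y powr m * \<bar>f' y\<bar>) \<le> 1"
      proof (rule order_trans)
        show "ereal (y powr m * \<bar>f' y\<bar>) \<le> E" using elim y by simp
      qed fact
      then have "y powr m * \<bar>f' y\<bar> \<le> 1" by (simp add: one_ereal_def)
      then show "\<bar>f' y\<bar> \<le> y powr (- m)"
        using y by (simp add: powr_minus field_simps)
    qed
  qed
  then show thesis by (rule that[OF a])
qed

text \<open>For large \<open>x\<close> the essential supremum from \<open>x\<close> on is at most
  \<open>x powr (- 1 - \<delta>)\<close>. Evaluating it at the floor of \<open>y\<close> gives a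
  pointwise a.e. bound, at the cost of a factor \<open>2 powr (1 + \<delta>)\<close> because that
  floor is at least \<open>y / 2\<close>.\<close>

lemma esssup_bound_at_top:
  fixes f f' :: "real \<Rightarrow> real" and \<alpha> \<delta> :: real
  assumes "0 < \<delta>" and "((\<lambda>x. ereal (x powr (- \<alpha>) * \<bar>f x\<bar>)
        + ereal (x powr (1 + \<delta>)) *
          esssup (restrict_space lebesgue {x..}) (\<lambda>y. ereal (y powr (- \<alpha>) * \<bar>f' y\<bar>))) \<longlongrightarrow> 0) at_top"
  obtains b K where "0 < b" "0 < K"
    "AE y in lborel. b \<le> y \<longrightarrow> \<bar>f' y\<bar> \<le> K * y powr (\<alpha> - 1 - \<delta>)"
proof -
  define E where "E = (\<lambda>x. esssup (restrict_space lebesgue {x..}) (\<lambda>y. ereal (y powr (- \<alpha>) * \<bar>f' y\<bar>)))"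
  have "\<forall>\<^sub>F x in at_top. ereal (x powr (- \<alpha>) * \<bar>f x\<bar>) + ereal (x powr (1 + \<delta>)) * E x < 1"
    unfolding E_def by (rule order_tendstoD(2)[OF assms(2)]) simp
  then have "\<forall>\<^sub>F x in at_top. E x \<le> ereal (x powr (- 1 - \<delta>))"
    using eventually_gt_at_top[of 0]
  proof eventually_elim
    case (elim x)
    show ?case
    proof (cases "E x")
      case (real r)
      have "0 \<le> x powr (- \<alpha>) * \<bar>f x\<bar>" by simp
      moreover have "x powr (- \<alpha>) * \<bar>f x\<bar> + x powr (1 + \<delta>) * r < 1"
        using elim unfolding real by (simp add: one_ereal_def)
      ultimately have "x powr (1 + \<delta>) * r \<le> 1" by linarith
      then have "r \<le> 1 / x powr (1 + \<delta>)"
        using elim by (simp add: field_simps)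
      also have "\<dots> = x powr (- 1 - \<delta>)"
        using powr_minus_divide[of x "1 + \<delta>"] by simp
      finally show ?thesis using real by simp
    qed (use elim in auto)
  qed
  then obtain b0 where b0: "\<And>x. b0 \<le> x \<Longrightarrow> E x \<le> ereal (x powr (- 1 - \<delta>))"
    by (auto simp: eventually_at_top_linorder)
  \<comment> \<open>\<open>N \<ge> 1\<close> makes the floor of any \<open>y \<ge> N\<close> at
    least \<open>y / 2\<close>, and \<open>N \<ge> b0\<close> keeps that floor in the range where
    \<open>E\<close> is controlled.\<close>
  define N where "N = nat \<lceil>max 1 b0\<rceil>"
  have N: "1 \<le> real N" "b0 \<le> real N" unfolding N_def by linarith+
  have "AE y in lborel. y \<in> {x..} \<longrightarrow> ereal (y powr (- \<alpha>) * \<bar>f' y\<bar>) \<le> E x" for x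
  proof -
    have "AE y in restrict_space lebesgue {x..}. ereal (y powr (- \<alpha>) * \<bar>f' y\<bar>) \<le> E x"
      unfolding E_def by (rule esssup_AE)
    then show ?thesis
      by (subst (asm) AE_restrict_space_iff) (auto simp: AE_completion_iff)
  qed
  \<comment> \<open>Each bound holds outside a null set depending on \<open>x\<close>, so only countably many \<open>x\<close> can be combined.\<close>
  then have "AE y in lborel. \<forall>n::nat. y \<in> {real n..} \<longrightarrow> ereal (y powr (- \<alpha>) * \<bar>f' y\<bar>) \<le> E (real n)"
    by (subst AE_all_countable) auto
  then have "AE y in lborel. real N \<le> y \<longrightarrow> \<bar>f' y\<bar> \<le> 2 powr (1 + \<delta>) * y powr (\<alpha> - 1 - \<delta>)"
  proof eventually_elim
    case (elim y)
    show ?case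
    proof
      assume y: "real N \<le> y"
      define n where "n = nat \<lfloor>y\<rfloor>"
      have "N \<le> n" unfolding n_def using y by (rule le_nat_floor)
      then have "real N \<le> real n" by simp
      moreover have "real n \<le> y" "y < real n + 1" unfolding n_def using N y by linarith+
      ultimately have n: "real n \<le> y" "y / 2 \<le> real n" "b0 \<le> real n" "0 < y / 2"
        using N y by linarith+
      have "ereal (y powr (- \<alpha>) * \<bar>f' y\<bar>) \<le> ereal (real n powr (- 1 - \<delta>))"
        using elim[rule_format, of n] n(1) b0[OF n(3)] order_trans by fastforce
      then have "y powr (- \<alpha>) * \<bar>f' y\<bar> \<le> real n powr (- 1 - \<delta>)" by simp
      also have "\<dots> \<le> (y / 2) powr (- 1 - \<delta>)"
        using n assms(1) by (intro powr_mono2') auto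
      also have "\<dots> = 2 powr (1 + \<delta>) * y powr (- 1 - \<delta>)"
        using n powr_minus_divide[of 2 "1 + \<delta>"] by (simp add: powr_divide)
      finally have "y powr \<alpha> * (y powr (- \<alpha>) * \<bar>f' y\<bar>) \<le> y powr \<alpha> * (2 powr (1 + \<delta>) * y powr (- 1 - \<delta>))"
        by (intro mult_left_mono) auto
      also have "\<dots> = 2 powr (1 + \<delta>) * y powr (\<alpha> - 1 - \<delta>)"
        using powr_add[of y \<alpha> "- 1 - \<delta>"] by (simp add: add_diff_eq)
      also have "y powr \<alpha> * (y powr (- \<alpha>) * \<bar>f' y\<bar>) = \<bar>f' y\<bar>"
        using n by (simp add: powr_minus)
      finally show "\<bar>f' y\<bar> \<le> 2 powr (1 + \<delta>) * y powr (\<alpha> - 1 - \<delta>)" .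
    qed
  qed
  then show thesis using N by (intro that[of "real N" "2 powr (1 + \<delta>)"]) auto
qed

text \<open>\<open>g\<close> stands for the Borel version of \<open>f'\<close>. The exponents at
  infinity are matched: a weight of order \<open>y powr (- \<alpha>)\<close> times \<open>g\<close>
  is of order \<open>y powr (- 1 - \<delta>)\<close>, which is integrable there.\<close>

locale power_growth =
  fixes g :: "real \<Rightarrow> real" and \<alpha> \<delta> M a b K :: real
  assumes g_borel[measurable]: "g \<in> borel_measurable borel"
    and g_local: "\<And>x y. 0 < x \<Longrightarrow> set_integrable lborel {x..y} g"
    and pos: "0 < \<delta>" "0 < a" "0 < b" "0 < K"
    and g_at_0: "AE y in lborel. 0 < y \<and> y < a \<longrightarrow> \<bar>g y\<bar> \<le> y powr (- M)"
    and g_at_top: "AE y in lborel. b \<le> y \<longrightarrow> \<bar>g y\<bar> \<le> K * y powr (\<alpha> - 1 - \<delta>)"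
begin

text \<open>The half-line is cut at \<open>r\<close> and \<open>R\<close>. Below \<open>r\<close>
  the two powers cancel and the product is bounded, on [r, R] a bounded weight meets the integrable
  \<open>g\<close>, and beyond \<open>R\<close> the product is dominated by a multiple of
  \<open>y powr (- 1 - \<delta>)\<close>.\<close>

lemma weighted_integrable:
  fixes w :: "real \<Rightarrow> real"
  assumes w[measurable]: "w \<in> borel_measurable borel"
    and w0: "w \<in> O[at_right 0](\<lambda>y. y powr M)"
    and w1: "w \<in> O(\<lambda>y. y powr (- \<alpha>))"
    and wloc: "\<And>x y. 0 < x \<Longrightarrow> \<exists>B. \<forall>u\<in>{x..y}. \<bar>w u\<bar> \<le> B"
  shows "set_integrable lborel {0<..} (\<lambda>y. w y * g y)"
proof -
  obtain c0 where c0: "0 < c0" "\<forall>\<^sub>F y in at_right 0. \<bar>w y\<bar> \<le> c0 * \<bar>y powr M\<bar>"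
    using landau_o.bigE[OF w0] by auto
  have "\<forall>\<^sub>F y in at_right 0. y < a"
    using eventually_at_right_real[OF pos(2)] by eventually_elim simp
  with c0(2) have "\<forall>\<^sub>F y in at_right 0. \<bar>w y\<bar> \<le> c0 * \<bar>y powr M\<bar> \<and> y < a"
    by eventually_elim simp
  then obtain r where r: "0 < r" "\<And>y. 0 < y \<Longrightarrow> y < r \<Longrightarrow> \<bar>w y\<bar> \<le> c0 * y powr M"
    "\<And>y. 0 < y \<Longrightarrow> y < r \<Longrightarrow> y < a"
    by (auto simp: eventually_at_right_field)
  obtain c1 where c1: "0 < c1" "\<forall>\<^sub>F y in at_top. \<bar>w y\<bar> \<le> c1 * \<bar>y powr (- \<alpha>)\<bar>"
    using landau_o.bigE[OF w1] by auto
  \<comment> \<open>Carrying \<open>max b r \<le> y\<close> in the same statement forces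
    \<open>R\<close> itself to lie beyond \<open>b\<close> and \<open>r\<close>.\<close>
  from c1(2) eventually_ge_at_top[of "max b r"]
  have "\<forall>\<^sub>F y in at_top. \<bar>w y\<bar> \<le> c1 * y powr (- \<alpha>) \<and> max b r \<le> y"
    by eventually_elim simp
  then obtain R where R: "\<And>y. R \<le> y \<Longrightarrow> \<bar>w y\<bar> \<le> c1 * y powr (- \<alpha>) \<and> max b r \<le> y"
    by (auto simp: eventually_at_top_linorder)
  then have "b \<le> R" "r \<le> R" by force+
  obtain B where B: "\<And>u. u \<in> {r..R} \<Longrightarrow> \<bar>w u\<bar> \<le> B" using wloc[OF r(1)] by blast
  define D where "D = (\<lambda>y. c0 * indicator {0<..<r} y + B * (indicator {r..R} y * \<bar>g y\<bar>)
    + (c1 * K) * (indicator {R..} y * y powr (- 1 - \<delta>)))"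
  have D_int: "integrable lborel D"
  proof -
    have "integrable lborel (\<lambda>y. indicator {r..R} y * \<bar>g y\<bar>)"
      using set_integrable_abs[OF g_local[OF r(1), of R]] by (simp add: set_integrable_def)
    moreover have "integrable lborel (\<lambda>y. indicator {R..} y * y powr (- 1 - \<delta>))"
      using set_integrable_powr_at_top[of R \<delta>] pos \<open>b \<le> R\<close> by (simp add: set_integrable_def)
    moreover have "integrable lborel (indicator {0<..<r} :: real \<Rightarrow> real)"
      using r(1) by (intro integrable_real_indicator) auto
    ultimately show ?thesis
      unfolding D_def by (intro Bochner_Integration.integrable_add integrable_mult_right)
  qed
  show ?thesis
    unfolding set_integrable_def
  proof (rule Bochner_Integration.integrable_bound[OF D_int])
    show "AE y in lborel. norm (indicator {0<..} y *\<^sub>R (w y * g y)) \<le> norm (D y)"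
      using g_at_0 g_at_top
    proof eventually_elim
      case (elim y)
      have "0 \<le> B" using B[of r] \<open>r \<le> R\<close> by (auto intro: order_trans[OF abs_ge_zero])
      consider "y \<le> 0" | "0 < y" "y < r" | "r \<le> y" "y < R" | "R \<le> y" by linarith
      then show ?case
      proof cases
        case 2
        have "\<bar>w y\<bar> * \<bar>g y\<bar> \<le> (c0 * y powr M) * y powr (- M)"
          using 2 r elim(1) c0(1) by (intro mult_mono) auto
        also have "\<dots> = c0" using 2 by (simp add: powr_minus)
        finally show ?thesis
          using 2 c0(1) \<open>r \<le> R\<close> by (simp add: D_def abs_mult)
      next
        case 3
        have "\<bar>w y\<bar> * \<bar>g y\<bar> \<le> B * \<bar>g y\<bar>" using B[of y] 3 by (intro mult_right_mono) auto
        then show ?thesis using 3 \<open>0 \<le> B\<close> r(1) by (simp add: D_def abs_mult)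
      next
        case 4
        then have y: "0 < y" using r(1) \<open>r \<le> R\<close> by linarith
        have "\<bar>w y\<bar> * \<bar>g y\<bar> \<le> (c1 * y powr (- \<alpha>)) * (K * y powr (\<alpha> - 1 - \<delta>))"
          using 4 R[of y] elim(2) \<open>b \<le> R\<close> c1 pos by (intro mult_mono) auto
        also have "\<dots> = (c1 * K) * (y powr (- \<alpha>) * y powr (\<alpha> - 1 - \<delta>))" by simp
        also have "y powr (- \<alpha>) * y powr (\<alpha> - 1 - \<delta>) = y powr (- 1 - \<delta>)"
          by (simp add: powr_add[symmetric])
        finally have *: "\<bar>w y\<bar> * \<bar>g y\<bar> \<le> (c1 * K) * y powr (- 1 - \<delta>)" .
        \<comment> \<open>At \<open>y = R\<close> the last two terms of \<open>D\<close> are both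
          active; the inequality survives since \<open>0 \<le> B\<close>.\<close>
        have "(c1 * K) * y powr (- 1 - \<delta>) \<le> D y"
          using 4 r(1) \<open>r \<le> R\<close> \<open>0 \<le> B\<close> by (auto simp: D_def indicator_def)
        with * show ?thesis using y by (simp add: abs_mult)
      qed simp
    qed
  qed simp
qed

text \<open>Near 0 the weight is \<open>- H y\<close>, which decays faster than any power of
  \<open>y\<close>; at infinity it is \<open>1 - H y\<close>; in between it is bounded by 1.\<close>

lemma cdf_weight_integrable:
  fixes H :: "real \<Rightarrow> real"
  assumes H[measurable]: "H \<in> borel_measurable borel" and H01: "\<And>y. 0 \<le> H y" "\<And>y. H y \<le> 1"
    and k: "0 < k" "0 < \<kappa>"
    and H0: "\<And>y. 0 < y \<Longrightarrow> y < 1 \<Longrightarrow> H y \<le> exp (- k * y powr (- \<kappa>))"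
    and H1: "\<And>y. R \<le> y \<Longrightarrow> 1 - H y \<le> C * y powr (- \<alpha>)"
  shows "set_integrable lborel {0<..} (\<lambda>y. (indicator {1..} y - H y) * g y)"
proof (rule weighted_integrable)
  have "(\<lambda>y. indicator {1..} y - H y) \<in> O[at_right 0](\<lambda>y. exp (- k * y powr (- \<kappa>)))"
  proof (rule landau_o.bigI[of 1])
    have "\<forall>\<^sub>F y::real in at_right 0. y \<in> {0<..<1}" by (rule eventually_at_right_real) simp
    then show "\<forall>\<^sub>F y in at_right 0. norm (indicator {1..} y - H y) \<le> 1 * norm (exp (- k * y powr (- \<kappa>)))"
      by eventually_elim (use H01 H0 in auto)
  qed simp
  also have "(\<lambda>y. exp (- k * y powr (- \<kappa>))) \<in> O[at_right 0](\<lambda>y. y powr M)"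
    using k by real_asymp
  finally show "(\<lambda>y. indicator {1..} y - H y) \<in> O[at_right 0](\<lambda>y. y powr M)" .
  show "(\<lambda>y. indicator {1..} y - H y) \<in> O(\<lambda>y. y powr (- \<alpha>))"
  proof (rule bigoI[of _ C])
    show "\<forall>\<^sub>F y in at_top. norm (indicator {1..} y - H y) \<le> C * norm (y powr (- \<alpha>))"
      using eventually_ge_at_top[of "max 1 R"]
      by eventually_elim (use H01 H1 in auto)
  qed
  have "\<bar>indicator {1..} u - H u\<bar> \<le> 1" for u
    using H01[of u] by (auto simp: indicator_def abs_le_iff)
  then show "\<exists>B. \<forall>u\<in>{x..y}. \<bar>indicator {1..} u - H u\<bar> \<le> B" for x y by blast
qed simp

text \<open>The exponential beats every power at 0, so only infinity restricts \<open>q\<close>. For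
  \<open>q \<le> - \<alpha>\<close> the weight is small enough there; the second claim cuts at 1 and
  so admits every \<open>q\<close>.\<close>

lemma powr_exp_weight_integrable:
  fixes q k \<kappa> :: real
  assumes k: "0 < k" "0 < \<kappa>"
  shows "q \<le> - \<alpha> \<Longrightarrow> set_integrable lborel {0<..} (\<lambda>y. y powr q * exp (- k * y powr (- \<kappa>)) * g y)"
    and "set_integrable lborel {0<..<1} (\<lambda>y. y powr q * exp (- k * y powr (- \<kappa>)) * g y)"
proof -
  let ?w = "\<lambda>y. y powr q * exp (- k * y powr (- \<kappa>))"
  have w0: "?w \<in> O[at_right 0](\<lambda>y. y powr M)"
    using k by real_asymp
  have loc: "\<exists>B. \<forall>u\<in>{x..y}. \<bar>?w u\<bar> \<le> B" if "0 < x" for x y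
  proof -
    have "continuous_on {x..y} ?w"
      using that by (intro continuous_intros) auto
    then have "bounded (?w ` {x..y})"
      by (intro compact_imp_bounded compact_continuous_image) auto
    then show ?thesis by (auto simp: bounded_iff)
  qed
  {
    assume q: "q \<le> - \<alpha>"
    show "set_integrable lborel {0<..} (\<lambda>y. ?w y * g y)"
    proof (rule weighted_integrable[OF _ w0 _ loc])
      show "?w \<in> O(\<lambda>y. y powr (- \<alpha>))"
      proof (rule bigoI[of _ 1])
        show "\<forall>\<^sub>F y in at_top. norm (?w y) \<le> 1 * norm (y powr (- \<alpha>))"
          using eventually_ge_at_top[of 1]
        proof eventually_elim
          case (elim y)
          have "y powr q * exp (- k * y powr (- \<kappa>)) \<le> y powr (- \<alpha>) * 1"
            using elim q k by (intro mult_mono powr_mono) auto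
          then show ?case by simp
        qed
      qed
    qed simp_all
  }
  have "set_integrable lborel {0<..} (\<lambda>y. (indicator {0<..<1} y * ?w y) * g y)"
  proof (rule weighted_integrable)
    have "(\<lambda>y. indicator {0<..<1} y * ?w y) \<in> O[at_right 0](?w)"
      by (rule bigoI[of _ 1]) (auto simp: indicator_def)
    then show "(\<lambda>y. indicator {0<..<1} y * ?w y) \<in> O[at_right 0](\<lambda>y. y powr M)"
      using w0 by (rule landau_o.big_trans)
    \<comment> \<open>The cut weight vanishes for \<open>y \<ge> 1\<close>, hence the constant
      0.\<close>
    have "\<forall>\<^sub>F y in at_top. norm (indicator {0<..<1} y * ?w y) \<le> 0 * norm (y powr (- \<alpha>))"
      using eventually_ge_at_top[of 1] by eventually_elim simp
    then show "(\<lambda>y. indicator {0<..<1} y * ?w y) \<in> O(\<lambda>y. y powr (- \<alpha>))"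
      by (rule bigoI)
    show "\<exists>B. \<forall>u\<in>{x..y}. \<bar>indicator {0<..<1} u * ?w u\<bar> \<le> B" if x: "0 < x" for x y
    proof -
      obtain B where B: "\<And>u. u \<in> {x..y} \<Longrightarrow> \<bar>?w u\<bar> \<le> B" using loc[OF x] by blast
      have "\<bar>indicator {0<..<1} u * ?w u\<bar> \<le> B" if "u \<in> {x..y}" for u
      proof -
        have "\<bar>indicator {0<..<1} u * ?w u\<bar> \<le> \<bar>?w u\<bar>" by (simp add: indicator_def)
        then show ?thesis using B[OF that] by (rule order_trans)
      qed
      then show ?thesis by blast
    qed
  qed simp
  then show "set_integrable lborel {0<..<1} (\<lambda>y. ?w y * g y)"
    unfolding set_integrable_def
    by (simp add: indicator_inter_arith[symmetric] mult.assoc[symmetric] greaterThanLessThan_def)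
qed

end

section \<open>Distribution functions of normalized maxima\<close>

text \<open>With \<open>a \<le> b\<close> by symmetry, the larger exponential
  \<open>exp (- a * t)\<close> is factored out and bounded by \<open>exp (- c * t)\<close>; the rest
  is 1 - exp(-u) \<le> u with \<open>u = (b - a) * t\<close>.\<close>

lemma abs_exp_diff_le:
  fixes a b c t :: real
  assumes "0 \<le> t" "c \<le> a" "c \<le> b"
  shows "\<bar>exp (- a * t) - exp (- b * t)\<bar> \<le> t * \<bar>a - b\<bar> * exp (- c * t)"
  using assms(2,3)
proof (induction a b rule: linorder_wlog)
  case (le a b)
  have "\<bar>exp (- a * t) - exp (- b * t)\<bar> = exp (- a * t) - exp (- b * t)"
    using le assms(1) by (simp add: mult_right_mono)
  also have "\<dots> = exp (- a * t) * (1 - exp (- ((b - a) * t)))"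
    by (simp add: algebra_simps flip: exp_add)
  also have "\<dots> \<le> exp (- c * t) * ((b - a) * t)"
  proof (rule mult_mono)
    show "exp (- a * t) \<le> exp (- c * t)"
      using le assms(1) by (simp add: mult_right_mono)
    show "1 - exp (- ((b - a) * t)) \<le> (b - a) * t"
      using exp_ge_add_one_self[of "- ((b - a) * t)"] by linarith
  qed (use le assms(1) in auto)
  finally show ?case using le by (simp add: mult_ac)
qed (simp add: abs_minus_commute)

lemma (in prob_space) AE_pos_if_cdf_0:
  fixes Y :: "'a \<Rightarrow> real"
  assumes [measurable]: "Y \<in> borel_measurable M" and "cdf (distr M borel Y) 0 = 0"
  shows "AE \<omega> in M. 0 < Y \<omega>"
proof -
  have "prob {\<omega> \<in> space M. Y \<omega> \<le> 0} = 0"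
    using assms(2) unfolding cdf_def
    by (subst (asm) measure_distr) (auto simp: vimage_def Int_def conj_commute)
  then have "AE \<omega> in M. \<not> Y \<omega> \<le> 0"
    by (subst (asm) prob_eq_0) auto
  then show ?thesis by eventually_elim simp
qed

lemma (in prob_space) cdf_distr_borel_01:
  assumes "Y \<in> borel_measurable M"
  shows "cdf (distr M borel Y) \<in> borel_measurable borel"
    and "0 \<le> cdf (distr M borel Y) y" and "cdf (distr M borel Y) y \<le> 1"
proof -
  interpret D: real_distribution "distr M borel Y" using assms by (rule real_distribution_distr)
  show "cdf (distr M borel Y) \<in> borel_measurable borel"
    by (intro borel_measurable_mono monoI D.cdf_nondecreasing)
  show "0 \<le> cdf (distr M borel Y) y" "cdf (distr M borel Y) y \<le> 1"
    by (rule D.cdf_nonneg, rule D.cdf_bounded_prob)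
qed

lemma (in prob_space) normalized_max_measurable:
  assumes "indep_vars (\<lambda>_. borel) X {1..}"
  shows "normalized_max \<alpha> X n \<in> borel_measurable M"
proof -
  have "X i \<in> borel_measurable M" if "i \<in> {1..n}" for i
    using assms that by (auto simp: indep_vars_def)
  then show ?thesis
    unfolding normalized_max_def by (intro borel_measurable_times borel_measurable_Max) auto
qed

text \<open>A maximum stays below a level iff every \<open>X i\<close> does, and independence turns
  the intersection into a product; \<open>n \<ge> 1\<close> keeps the set of values
  nonempty.\<close>

lemma (in prob_space) normalized_max_cdf_eq:
  assumes X: "indep_vars (\<lambda>_. borel) X {1..}"
    and F: "\<And>i. i \<ge> 1 \<Longrightarrow> cdf (distr M borel (X i)) = F"
    and n: "n \<ge> 1"
  shows "normalized_max_cdf M \<alpha> X n x = F (real n powr (1 / \<alpha>) * x) ^ n"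
proof -
  have X_meas: "X i \<in> borel_measurable M" if "i \<ge> 1" for i
    using X that by (auto simp: indep_vars_def)
  let ?y = "real n powr (1 / \<alpha>) * x"
  have le_iff: "normalized_max \<alpha> X n \<omega> \<le> x \<longleftrightarrow> (\<forall>i\<in>{1..n}. X i \<omega> \<le> ?y)" for \<omega>
  proof -
    have "normalized_max \<alpha> X n \<omega> \<le> x \<longleftrightarrow> Max ((\<lambda>i. X i \<omega>) ` {1..n}) \<le> ?y"
      using n by (simp add: normalized_max_def powr_minus field_simps)
    also have "\<dots> \<longleftrightarrow> (\<forall>i\<in>{1..n}. X i \<omega> \<le> ?y)"
      using n by (subst Max_le_iff) auto
    finally show ?thesis .
  qed
  have "normalized_max_cdf M \<alpha> X n x = prob (normalized_max \<alpha> X n -` {..x} \<inter> space M)"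
    unfolding normalized_max_cdf_def cdf_def
    using normalized_max_measurable[OF X] by (subst measure_distr) auto
  also have "normalized_max \<alpha> X n -` {..x} \<inter> space M = (\<Inter>i\<in>{1..n}. X i -` {..?y} \<inter> space M)"
    using n by (auto simp: le_iff)
  also have "prob \<dots> = (\<Prod>i\<in>{1..n}. prob (X i -` {..?y} \<inter> space M))"
    using n by (intro indep_varsD[OF X]) auto
  also have "\<dots> = (\<Prod>i\<in>{1..n}. F ?y)"
  proof (rule prod.cong)
    fix i assume "i \<in> {1..n}"
    then have "1 \<le> i" by simp
    then show "prob (X i -` {..?y} \<inter> space M) = F ?y"
      using X_meas[OF \<open>1 \<le> i\<close>] unfolding F[OF \<open>1 \<le> i\<close>, symmetric] cdf_def
      by (simp add: measure_distr)
  qed simp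
  finally show ?thesis by simp
qed

text \<open>The extended-real \<sigma> is eliminated: \<open>s\<close> in \<open>F_rate\<close>
  stands for \<sigma>(x)^\<alpha>, finite from \<open>x\<^sub>0\<close> on, and
  \<open>F_lower\<close> also covers the points where F(x) = 0. The choice
  \<open>1 \<le> x\<^sub>0\<close> keeps the rate term at most \<open>C\<^sub>1\<close> in the
  tail.\<close>

locale frechet_attraction =
  fixes F :: "real \<Rightarrow> real" and \<alpha> \<sigma>\<^sub>0 \<beta> C\<^sub>1 C\<^sub>2 \<gamma> x\<^sub>0 :: real
  assumes pos: "0 < \<alpha>" "0 < \<sigma>\<^sub>0" "0 < \<beta>" "0 < C\<^sub>1" "0 < C\<^sub>2" "0 < \<gamma>" "\<gamma> < \<alpha>" "1 \<le> x\<^sub>0"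
    and F01: "\<And>x. 0 \<le> F x" "\<And>x. F x \<le> 1"
    and F_lower: "\<And>x. 0 < x \<Longrightarrow> F x \<le> exp (- (C\<^sub>2 * min 1 (x powr \<gamma>)) * x powr (- \<alpha>))"
    and F_rate: "\<And>x. x\<^sub>0 \<le> x \<Longrightarrow>
      \<exists>s. \<bar>s - \<sigma>\<^sub>0 powr \<alpha>\<bar> \<le> C\<^sub>1 * x powr (- \<beta>) \<and> F x = exp (- s * x powr (- \<alpha>))"
begin

text \<open>By \<open>normalized_max_cdf_eq\<close> this is the distribution function of the
  normalized maximum, written through \<open>F\<close> alone so that its estimates involve no
  probability space.\<close>

definition Fn :: "nat \<Rightarrow> real \<Rightarrow> real" where
  "Fn n x = F (real n powr (1 / \<alpha>) * x) ^ n"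

lemma Fn01: "0 \<le> Fn n x" "Fn n x \<le> 1"
  by (simp_all add: Fn_def F01 power_le_one)

text \<open>Raising \<open>n powr (1 / \<alpha>)\<close> to the power \<open>- \<alpha>\<close>
  gives 1/n, which cancels the n-th power: the max-stability of the Frechet law.\<close>

lemma exp_scaled_power:
  assumes "n \<ge> 1" "0 < x"
  shows "exp (- s * (real n powr (1 / \<alpha>) * x) powr (- \<alpha>)) ^ n = exp (- s * x powr (- \<alpha>))"
proof -
  have "(real n powr (1 / \<alpha>) * x) powr (- \<alpha>) = x powr (- \<alpha>) / real n"
    using assms pos by (simp add: powr_mult powr_powr powr_minus divide_inverse)
  then show ?thesis
    using assms by (simp flip: exp_of_nat_mult)
qed

text \<open>The argument y = n^(1/\<alpha>) x is at least x and x < 1, so min(1, y^\<gamma>) is at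
  least x^\<gamma>. Only this factor is changed; \<open>?y powr (- \<alpha>)\<close> is kept because
  it absorbs the n-th power, which makes the bound uniform in \<open>n\<close>.\<close>

lemma Fn_le:
  assumes n: "n \<ge> 1" and x: "0 < x" "x < 1"
  shows "Fn n x \<le> exp (- C\<^sub>2 * x powr (- (\<alpha> - \<gamma>)))"
proof -
  let ?y = "real n powr (1 / \<alpha>) * x"
  have n1: "1 \<le> real n powr (1 / \<alpha>)"
    using n pos by (intro ge_one_powr_ge_zero) auto
  then have "x \<le> ?y"
    using x by (simp add: mult_le_cancel_right1)
  then have y: "x \<le> ?y" "0 < ?y"
    using x by linarith+
  have "x powr \<gamma> \<le> min 1 (?y powr \<gamma>)"
    using x y pos by (auto intro!: powr_mono2 powr_le1)
  then have "exp (- (C\<^sub>2 * min 1 (?y powr \<gamma>)) * ?y powr (- \<alpha>)) \<le> exp (- (C\<^sub>2 * x powr \<gamma>) * ?y powr (- \<alpha>))"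
    using pos by (simp add: mult_right_mono)
  with F_lower[OF y(2)] have "F ?y \<le> exp (- (C\<^sub>2 * x powr \<gamma>) * ?y powr (- \<alpha>))" by linarith
  then have "Fn n x \<le> exp (- (C\<^sub>2 * x powr \<gamma>) * ?y powr (- \<alpha>)) ^ n"
    unfolding Fn_def by (rule power_mono) (rule F01)
  also have "\<dots> = exp (- (C\<^sub>2 * x powr \<gamma>) * x powr (- \<alpha>))"
    by (rule exp_scaled_power[OF n x(1)])
  also have "(C\<^sub>2 * x powr \<gamma>) * x powr (- \<alpha>) = C\<^sub>2 * x powr (- (\<alpha> - \<gamma>))"
    by (simp add: powr_add[symmetric] mult.assoc)
  then have "exp (- (C\<^sub>2 * x powr \<gamma>) * x powr (- \<alpha>)) = exp (- C\<^sub>2 * x powr (- (\<alpha> - \<gamma>)))"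
    by (metis mult_minus_left)
  finally show ?thesis .
qed

lemma Fn_eq:
  assumes n: "n \<ge> 1" and x: "0 < x" and y: "x\<^sub>0 \<le> real n powr (1 / \<alpha>) * x"
  obtains s where "\<bar>s - \<sigma>\<^sub>0 powr \<alpha>\<bar> \<le> C\<^sub>1 * (real n powr (1 / \<alpha>) * x) powr (- \<beta>)"
    "Fn n x = exp (- s * x powr (- \<alpha>))"
proof -
  obtain s where s: "\<bar>s - \<sigma>\<^sub>0 powr \<alpha>\<bar> \<le> C\<^sub>1 * (real n powr (1 / \<alpha>) * x) powr (- \<beta>)"
    "F (real n powr (1 / \<alpha>) * x) = exp (- s * (real n powr (1 / \<alpha>) * x) powr (- \<alpha>))"
    using F_rate[OF y] by blast
  show thesis
    using that[OF s(1)] exp_scaled_power[OF n x] by (simp add: Fn_def s(2))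
qed

text \<open>The argument of \<open>F\<close> is at least 1 here, so \<open>s\<close> exceeds
  \<open>\<sigma>\<^sub>0 powr \<alpha>\<close> by at most \<open>C\<^sub>1\<close>, uniformly in
  \<open>n\<close>; then 1 - exp(-u) \<le> u applies.\<close>

lemma Fn_tail:
  assumes n: "n \<ge> 1" and x: "x\<^sub>0 \<le> x"
  shows "1 - Fn n x \<le> (\<sigma>\<^sub>0 powr \<alpha> + C\<^sub>1) * x powr (- \<alpha>)"
proof -
  have x_pos: "0 < x" using x pos by linarith
  have "1 \<le> real n powr (1 / \<alpha>)"
    using n pos by (intro ge_one_powr_ge_zero) auto
  then have "x \<le> real n powr (1 / \<alpha>) * x"
    using x_pos by (simp add: mult_le_cancel_right1)
  then have y: "x\<^sub>0 \<le> real n powr (1 / \<alpha>) * x" "1 \<le> real n powr (1 / \<alpha>) * x"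
    using x pos by linarith+
  obtain s where s: "\<bar>s - \<sigma>\<^sub>0 powr \<alpha>\<bar> \<le> C\<^sub>1 * (real n powr (1 / \<alpha>) * x) powr (- \<beta>)"
    "Fn n x = exp (- s * x powr (- \<alpha>))"
    by (rule Fn_eq[OF n x_pos y(1)])
  have "(real n powr (1 / \<alpha>) * x) powr (- \<beta>) \<le> (real n powr (1 / \<alpha>) * x) powr 0"
    using y pos by (intro powr_mono) auto
  also have "\<dots> = 1" using n x_pos by simp
  finally have "C\<^sub>1 * (real n powr (1 / \<alpha>) * x) powr (- \<beta>) \<le> C\<^sub>1 * 1"
    using pos by (intro mult_left_mono) auto
  then have "s \<le> \<sigma>\<^sub>0 powr \<alpha> + C\<^sub>1" using s(1) by linarith
  then have "s * x powr (- \<alpha>) \<le> (\<sigma>\<^sub>0 powr \<alpha> + C\<^sub>1) * x powr (- \<alpha>)"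
    by (rule mult_right_mono) simp
  moreover have "1 - Fn n x \<le> s * x powr (- \<alpha>)"
    using exp_ge_add_one_self[of "- s * x powr (- \<alpha>)"] unfolding s(2) by simp
  ultimately show ?thesis by linarith
qed

text \<open>Multiplied by |f'| and integrated, this yields the explicit bound of part (b). The first
  term handles x \<ge> \<epsilon>(n), the second x < \<epsilon>(n).\<close>

lemma frechet_cdf_diff_bound:
  assumes eps: "\<epsilon> \<longlonglongrightarrow> 0"
    and eps_top: "filterlim (\<lambda>n. real n powr (1 / \<alpha>) * \<epsilon> n) at_top sequentially"
    and c: "c < \<sigma>\<^sub>0 powr \<alpha>"
  shows "\<forall>\<^sub>F n in sequentially. \<forall>x>0. \<bar>frechet_cdf \<alpha> \<sigma>\<^sub>0 x - Fn n x\<bar>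
    \<le> C\<^sub>1 * real n powr (- \<beta> / \<alpha>) * (x powr (- (\<alpha> + \<beta>)) * exp (- c * x powr (- \<alpha>)))
      + 2 * (indicator {0<..<\<epsilon> n} x * exp (- C\<^sub>2 * x powr (- (\<alpha> - \<gamma>))))"
proof -
  have "((\<lambda>y. C\<^sub>1 * y powr (- \<beta>)) \<longlongrightarrow> 0) at_top"
    using pos by real_asymp
  then have "\<forall>\<^sub>F y in at_top. C\<^sub>1 * y powr (- \<beta>) < \<sigma>\<^sub>0 powr \<alpha> - c"
    using c by (intro order_tendstoD(2)) auto
  \<comment> \<open>Beyond \<open>y\<^sub>1\<close> the rate error is less than the gap
    \<open>\<sigma>\<^sub>0 powr \<alpha> - c\<close>, which will force
    \<open>c \<le> s\<close>.\<close>
  then obtain y\<^sub>1 where y\<^sub>1: "\<And>y. y\<^sub>1 \<le> y \<Longrightarrow> C\<^sub>1 * y powr (- \<beta>) < \<sigma>\<^sub>0 powr \<alpha> - c"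
    by (auto simp: eventually_at_top_linorder)
  have "((\<lambda>x. C\<^sub>2 * x powr \<gamma>) \<longlongrightarrow> 0) (at_right 0)"
    using pos by real_asymp
  then have "\<forall>\<^sub>F x in at_right 0. C\<^sub>2 * x powr \<gamma> < \<sigma>\<^sub>0 powr \<alpha>"
    using pos by (intro order_tendstoD(2)) auto
  \<comment> \<open>Below \<open>r\<close> the Frechet function obeys the same exponential bound
    that \<open>Fn_le\<close> gives for \<open>Fn n\<close> below 1; hence
    \<open>\<epsilon> n < min 1 r\<close> next.\<close>
  then obtain r where r: "0 < r" "\<And>x. 0 < x \<Longrightarrow> x < r \<Longrightarrow> C\<^sub>2 * x powr \<gamma> < \<sigma>\<^sub>0 powr \<alpha>"
    by (auto simp: eventually_at_right_field)
  have "\<forall>\<^sub>F n in sequentially. \<epsilon> n < min 1 r"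
    using r(1) by (intro order_tendstoD(2)[OF eps]) auto
  moreover have "\<forall>\<^sub>F n in sequentially. max x\<^sub>0 y\<^sub>1 \<le> real n powr (1 / \<alpha>) * \<epsilon> n"
    using eps_top unfolding filterlim_at_top by blast
  ultimately show ?thesis
    using eventually_ge_at_top[of 1]
  proof eventually_elim
    case (elim n)
    then have n: "1 \<le> n" by simp
    show ?case
    proof (intro allI impI)
      fix x :: real assume x: "0 < x"
      let ?G = "exp (- (\<sigma>\<^sub>0 powr \<alpha>) * x powr (- \<alpha>))"
      let ?w = "exp (- C\<^sub>2 * x powr (- (\<alpha> - \<gamma>)))"
      let ?v = "C\<^sub>1 * real n powr (- \<beta> / \<alpha>) * (x powr (- (\<alpha> + \<beta>)) * exp (- c * x powr (- \<alpha>)))"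
      have G: "frechet_cdf \<alpha> \<sigma>\<^sub>0 x = ?G" using x by (simp add: frechet_cdf_def)
      have v: "0 \<le> ?v" using pos by simp
      show "\<bar>frechet_cdf \<alpha> \<sigma>\<^sub>0 x - Fn n x\<bar> \<le> ?v + 2 * (indicator {0<..<\<epsilon> n} x * ?w)"
      proof (cases "x < \<epsilon> n")
        case True
        have "C\<^sub>2 * x powr \<gamma> * x powr (- \<alpha>) \<le> \<sigma>\<^sub>0 powr \<alpha> * x powr (- \<alpha>)"
          using r(2)[OF x] True elim by (intro mult_right_mono) auto
        also have "C\<^sub>2 * x powr \<gamma> * x powr (- \<alpha>) = C\<^sub>2 * x powr (- (\<alpha> - \<gamma>))"
          by (simp add: powr_add[symmetric] mult.assoc)
        finally have "?G \<le> ?w" by simp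
        moreover have "Fn n x \<le> ?w" using Fn_le[OF n x] True elim by simp
        moreover have "0 \<le> Fn n x" by (rule Fn01)
        moreover have "0 \<le> ?G" by simp
        \<comment> \<open>Both values lie between 0 and \<open>?w\<close>; the factor 2 of the
          second term arises here.\<close>
        ultimately have "\<bar>?G - Fn n x\<bar> \<le> 2 * ?w" by linarith
        then show ?thesis using True x v by (simp add: G)
      next
        case False
        then have "real n powr (1 / \<alpha>) * \<epsilon> n \<le> real n powr (1 / \<alpha>) * x"
          by (intro mult_left_mono) auto
        then have y: "x\<^sub>0 \<le> real n powr (1 / \<alpha>) * x" "y\<^sub>1 \<le> real n powr (1 / \<alpha>) * x"
          using elim by linarith+
        obtain s where s: "\<bar>s - \<sigma>\<^sub>0 powr \<alpha>\<bar> \<le> C\<^sub>1 * (real n powr (1 / \<alpha>) * x) powr (- \<beta>)"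
          "Fn n x = exp (- s * x powr (- \<alpha>))"
          by (rule Fn_eq[OF n x y(1)])
        have "c \<le> s" using s(1) y\<^sub>1[OF y(2)] by linarith
        then have "\<bar>?G - Fn n x\<bar> \<le> x powr (- \<alpha>) * \<bar>\<sigma>\<^sub>0 powr \<alpha> - s\<bar> * exp (- c * x powr (- \<alpha>))"
          unfolding s(2) using c by (intro abs_exp_diff_le) auto
        also have "\<dots> \<le> x powr (- \<alpha>) * (C\<^sub>1 * (real n powr (1 / \<alpha>) * x) powr (- \<beta>)) * exp (- c * x powr (- \<alpha>))"
          using s(1) by (intro mult_right_mono mult_left_mono) (auto simp: abs_minus_commute)
        also have "(real n powr (1 / \<alpha>) * x) powr (- \<beta>) = real n powr (- \<beta> / \<alpha>) * x powr (- \<beta>)"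
          using x by (simp add: powr_mult powr_powr)
        also have "x powr (- \<alpha>) * (C\<^sub>1 * (real n powr (- \<beta> / \<alpha>) * x powr (- \<beta>))) * exp (- c * x powr (- \<alpha>))
            = C\<^sub>1 * real n powr (- \<beta> / \<alpha>) * ((x powr (- \<alpha>) * x powr (- \<beta>)) * exp (- c * x powr (- \<alpha>)))"
          by (simp only: mult_ac)
        also have "x powr (- \<alpha>) * x powr (- \<beta>) = x powr (- (\<alpha> + \<beta>))"
          by (simp add: powr_add[symmetric])
        finally show ?thesis using False by (simp add: G)
      qed
    qed
  qed
qed

end

theorem theorem3p1:
  fixes \<alpha> \<sigma>\<^sub>0 \<beta> C\<^sub>1 C\<^sub>2 \<gamma> m \<delta> :: real
    and F :: "real \<Rightarrow> real" and \<sigma> :: "real \<Rightarrow> ereal"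
    and P :: "'a measure" and X :: "nat \<Rightarrow> 'a \<Rightarrow> real"
    and Q :: "'b measure" and Z :: "'b \<Rightarrow> real"
    and f f' :: "real \<Rightarrow> real"
  assumes "\<alpha> > 0" and "\<sigma>\<^sub>0 > 0" and "\<beta> > 0" and "C\<^sub>1 > 0" and "C\<^sub>2 > 0" and "0 < \<gamma>" and "\<gamma> < \<alpha>"
    and F_cdf: "\<exists>N. real_distribution N \<and> F = cdf N"
    and F_0: "F 0 = 0"
    and \<sigma>_pos: "\<And>x. x > 0 \<Longrightarrow> \<sigma> x > 0"
    and F_\<sigma>: "\<And>x. x > 0 \<Longrightarrow>
      F x = (if \<sigma> x = \<infinity> then 0 else exp (- (real_of_ereal (\<sigma> x) powr \<alpha>) * x powr (- \<alpha>)))"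
    and \<sigma>_lim: "(\<sigma> \<longlongrightarrow> ereal \<sigma>\<^sub>0) at_top"
    and \<sigma>_rate: "\<forall>\<^sub>F x in at_top.
      \<bar>ereal_powr (\<sigma> x) \<alpha> - ereal (\<sigma>\<^sub>0 powr \<alpha>)\<bar> \<le> ereal (C\<^sub>1 * x powr (- \<beta>))"
    and \<sigma>_lower: "\<And>x. x > 0 \<Longrightarrow> ereal_powr (\<sigma> x) \<alpha> \<ge> ereal (C\<^sub>2 * min 1 (x powr \<gamma>))"
    and P: "prob_space P"
    and X_indep: "prob_space.indep_vars P (\<lambda>_. borel) X {1..}"
    and X_cdf: "\<And>i. i \<ge> 1 \<Longrightarrow> cdf (distr P borel (X i)) = F"
    and Q: "prob_space Q"
    and Z_rv: "Z \<in> borel_measurable Q"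
    and Z_cdf: "cdf (distr Q borel Z) = frechet_cdf \<alpha> \<sigma>\<^sub>0"
    and f_ac: "locally_abs_cont f f'"
    and "\<delta> > 0"
    and f_at_0: "((\<lambda>x. ereal (x powr m * \<bar>f x\<bar>)
        + esssup (restrict_space lebesgue {0<..x}) (\<lambda>y. ereal (y powr m * \<bar>f' y\<bar>))) \<longlongrightarrow> 0) (at_right 0)"
    and f_at_top: "((\<lambda>x. ereal (x powr (- \<alpha>) * \<bar>f x\<bar>)
        + ereal (x powr (1 + \<delta>)) *
          esssup (restrict_space lebesgue {x..}) (\<lambda>y. ereal (y powr (- \<alpha>) * \<bar>f' y\<bar>))) \<longlongrightarrow> 0) at_top"
  shows
    "(pos_integrable Q f Z \<and>
      (\<forall>n\<ge>1.
         pos_integrable P f (normalized_max \<alpha> X n) \<and>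
         set_integrable lebesgue {0<..}
           (\<lambda>x. (frechet_cdf \<alpha> \<sigma>\<^sub>0 x - normalized_max_cdf P \<alpha> X n x) * f' x) \<and>
         pos_expectation P f (normalized_max \<alpha> X n) - pos_expectation Q f Z =
           (LINT x:{0<..}|lebesgue. (frechet_cdf \<alpha> \<sigma>\<^sub>0 x - normalized_max_cdf P \<alpha> X n x) * f' x)))
     \<and>
     (set_integrable lebesgue {1..} (\<lambda>x. x powr (- (\<alpha> + \<beta>)) * \<bar>f' x\<bar>) \<longrightarrow>
       (\<forall>(\<epsilon> :: nat \<Rightarrow> real) c.
          (\<forall>n\<ge>1. \<epsilon> n > 0) \<and> \<epsilon> \<longlonglongrightarrow> 0 \<and>
          filterlim (\<lambda>n. real n powr (1 / \<alpha>) * \<epsilon> n) at_top sequentially \<and>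
          0 < c \<and> c < \<sigma>\<^sub>0 powr \<alpha> \<longrightarrow>
          (\<forall>\<^sub>F n in sequentially.
             \<bar>pos_expectation P f (normalized_max \<alpha> X n) - pos_expectation Q f Z\<bar> \<le>
               C\<^sub>1 * real n powr (- \<beta> / \<alpha>) *
                 (LINT x:{0<..}|lebesgue. x powr (- (\<alpha> + \<beta>)) * \<bar>f' x\<bar> * exp (- c * x powr (- \<alpha>)))
               + 2 * (LINT x:{0<..<\<epsilon> n}|lebesgue. exp (- C\<^sub>2 * x powr (- (\<alpha> - \<gamma>))) * \<bar>f' x\<bar>))) \<and>
       (\<exists>C>0. \<forall>\<^sub>F n in sequentially.
          \<bar>pos_expectation P f (normalized_max \<alpha> X n) - pos_expectation Q f Z\<bar>
            \<le> C * real n powr (- \<beta> / \<alpha>)))"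
proof -
  interpret P: prob_space P by (rule P)
  interpret Q: prob_space Q by (rule Q)
  let ?G = "frechet_cdf \<alpha> \<sigma>\<^sub>0"
  let ?M = "normalized_max \<alpha> X"
  have \<alpha>: "0 < \<alpha>" and \<sigma>\<^sub>0: "0 < \<sigma>\<^sub>0" and \<beta>: "0 < \<beta>" and C\<^sub>1: "0 < C\<^sub>1" and C\<^sub>2: "0 < C\<^sub>2"
    and \<gamma>: "0 < \<gamma>" "\<gamma> < \<alpha>" by fact+

  \<comment> \<open>Reduction of the hypotheses on \<open>F\<close> and \<sigma>\<close>
  have F01: "0 \<le> F x" "F x \<le> 1" for x
  proof -
    obtain N where N: "real_distribution N" "F = cdf N" using F_cdf by blast
    interpret N: real_distribution N by (rule N(1))
    show "0 \<le> F x" "F x \<le> 1"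
      unfolding N(2) by (rule N.cdf_nonneg, rule N.cdf_bounded_prob)
  qed
  define s where "s = (\<lambda>x. real_of_ereal (\<sigma> x) powr \<alpha>)"
  have F_lower: "F x \<le> exp (- (C\<^sub>2 * min 1 (x powr \<gamma>)) * x powr (- \<alpha>))" if "0 < x" for x
  proof (cases "\<sigma> x = \<infinity>")
    case False
    then have "C\<^sub>2 * min 1 (x powr \<gamma>) \<le> s x"
      using \<sigma>_lower[OF that] by (simp add: ereal_powr_def s_def)
    then have "C\<^sub>2 * min 1 (x powr \<gamma>) * x powr (- \<alpha>) \<le> s x * x powr (- \<alpha>)"
      by (rule mult_right_mono) simp
    then show ?thesis using False F_\<sigma>[OF that] by (simp add: s_def)
  qed (use F_\<sigma>[OF that] in simp)
  obtain x\<^sub>1 where x\<^sub>1: "\<And>x. x\<^sub>1 \<le> x \<Longrightarrow>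
      \<bar>ereal_powr (\<sigma> x) \<alpha> - ereal (\<sigma>\<^sub>0 powr \<alpha>)\<bar> \<le> ereal (C\<^sub>1 * x powr (- \<beta>))"
    using \<sigma>_rate by (auto simp: eventually_at_top_linorder)
  define x\<^sub>0 where "x\<^sub>0 = max 1 x\<^sub>1"
  have F_rate: "\<exists>r. \<bar>r - \<sigma>\<^sub>0 powr \<alpha>\<bar> \<le> C\<^sub>1 * x powr (- \<beta>) \<and> F x = exp (- r * x powr (- \<alpha>))"
    if x: "x\<^sub>0 \<le> x" for x
  proof (intro exI conjI)
    have "0 < x" using x by (simp add: x\<^sub>0_def)
    have *: "\<bar>ereal_powr (\<sigma> x) \<alpha> - ereal (\<sigma>\<^sub>0 powr \<alpha>)\<bar> \<le> ereal (C\<^sub>1 * x powr (- \<beta>))"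
      using x by (intro x\<^sub>1) (simp add: x\<^sub>0_def)
    \<comment> \<open>An infinite \<sigma>(x) would make the left-hand side infinite.\<close>
    then have fin: "\<sigma> x \<noteq> \<infinity>"
      by (auto simp: ereal_powr_def)
    show "\<bar>s x - \<sigma>\<^sub>0 powr \<alpha>\<bar> \<le> C\<^sub>1 * x powr (- \<beta>)"
      using * fin by (simp add: ereal_powr_def s_def)
    show "F x = exp (- s x * x powr (- \<alpha>))"
      using F_\<sigma>[OF \<open>0 < x\<close>] fin by (simp add: s_def)
  qed
  interpret frechet_attraction F \<alpha> \<sigma>\<^sub>0 \<beta> C\<^sub>1 C\<^sub>2 \<gamma> x\<^sub>0
    using \<alpha> \<sigma>\<^sub>0 \<beta> C\<^sub>1 C\<^sub>2 \<gamma> F01 F_lower F_rate by unfold_locales (auto simp: x\<^sub>0_def)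

  \<comment> \<open>A Borel version of \<open>f'\<close> and its power bounds\<close>
  obtain g where g[measurable]: "g \<in> borel_measurable borel"
    and f'_meas: "(\<lambda>x. indicator {0<..} x * f' x) \<in> borel_measurable lebesgue"
    and f'_eq: "AE x in lborel. 0 < x \<longrightarrow> f' x = g x"
    and g_local: "\<And>a b. 0 < a \<Longrightarrow> set_integrable lborel {a..b} g"
    and f_diff: "\<And>x y. 0 < x \<Longrightarrow> x \<le> y \<Longrightarrow> f y - f x = (LINT u:{x..<y}|lborel. g u)"
    using locally_abs_cont_borel_version[OF f_ac] by blast
  note transfer = set_lebesgue_borel_transfer[OF f'_meas g f'_eq]
  obtain a where a: "0 < a" "AE y in lborel. 0 < y \<and> y < a \<longrightarrow> \<bar>f' y\<bar> \<le> y powr (- m)"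
    using esssup_bound_at_0[OF f_at_0] by blast
  obtain b K where b: "0 < b" "0 < K" "AE y in lborel. b \<le> y \<longrightarrow> \<bar>f' y\<bar> \<le> K * y powr (\<alpha> - 1 - \<delta>)"
    using esssup_bound_at_top[OF \<open>\<delta> > 0\<close> f_at_top] by blast
  interpret power_growth g \<alpha> \<delta> m a b K
  proof
    show "AE y in lborel. 0 < y \<and> y < a \<longrightarrow> \<bar>g y\<bar> \<le> y powr (- m)"
      using a(2) f'_eq by eventually_elim auto
    show "AE y in lborel. b \<le> y \<longrightarrow> \<bar>g y\<bar> \<le> K * y powr (\<alpha> - 1 - \<delta>)"
      using b(3) f'_eq by eventually_elim (use b(1) in auto)
  qed (use g g_local \<open>\<delta> > 0\<close> a b in auto)

  \<comment> \<open>The expectation of f(Z)\<close>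
  note Z_props = Q.cdf_distr_borel_01[OF Z_rv, unfolded Z_cdf]
  note G_meas[measurable] = Z_props(1)
  have G_int: "set_integrable lborel {0<..} (\<lambda>y. (indicator {1..} y - ?G y) * g y)"
  \<comment> \<open>Near 0 the exponential bound holds with equality for these \<open>k\<close> and
    \<open>\<kappa>\<close>; the tail constant \<open>C\<close> comes from 1 - exp(-u) \<le>
    u.\<close>
  proof (rule cdf_weight_integrable[where k = "\<sigma>\<^sub>0 powr \<alpha>" and \<kappa> = \<alpha> and R = 1 and C = "\<sigma>\<^sub>0 powr \<alpha>"])
    show "1 - ?G y \<le> \<sigma>\<^sub>0 powr \<alpha> * y powr (- \<alpha>)" if "1 \<le> y" for y
      using exp_ge_add_one_self[of "- (\<sigma>\<^sub>0 powr \<alpha>) * y powr (- \<alpha>)"] that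
      by (simp add: frechet_cdf_def)
  qed (use Z_props \<alpha> \<sigma>\<^sub>0 in \<open>auto simp: frechet_cdf_def\<close>)
  have Z_pos: "AE \<omega> in Q. 0 < Z \<omega>"
    by (rule Q.AE_pos_if_cdf_0[OF Z_rv]) (simp add: Z_cdf frechet_cdf_def)
  have Z_int: "pos_integrable Q f Z"
    "pos_expectation Q f Z = f 1 + (LINT y:{0<..}|lborel. (indicator {1..} y - ?G y) * g y)"
    using f_diff by (intro Q.pos_expectation_eq_integral[OF Z_rv Z_pos Z_cdf[symmetric] g _ G_int]; simp)+

  \<comment> \<open>The expectations of \<open>f\<close> at the normalized maxima\<close>
  have Fn: "normalized_max_cdf P \<alpha> X n = Fn n" if "1 \<le> n" for n
    using P.normalized_max_cdf_eq[OF X_indep X_cdf that] by (simp add: Fn_def fun_eq_iff)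
  have M_rv: "?M n \<in> borel_measurable P" for n
    by (rule P.normalized_max_measurable[OF X_indep])
  have Fn_eq_cdf: "Fn n = cdf (distr P borel (?M n))" if "1 \<le> n" for n
    using Fn[OF that] by (simp add: normalized_max_cdf_def)
  have Fn_meas: "Fn n \<in> borel_measurable borel" if "1 \<le> n" for n
    unfolding Fn_eq_cdf[OF that] by (rule P.cdf_distr_borel_01[OF M_rv])
  have Fn_int: "set_integrable lborel {0<..} (\<lambda>y. (indicator {1..} y - Fn n y) * g y)" if n: "1 \<le> n" for n
    by (rule cdf_weight_integrable[OF Fn_meas[OF n] Fn01 C\<^sub>2 _ Fn_le[OF n] Fn_tail[OF n]])
       (use \<gamma> in auto)
  have M_pos: "AE \<omega> in P. 0 < ?M n \<omega>" if n: "1 \<le> n" for n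
    \<comment> \<open>\<open>Fn n 0\<close> is \<open>F 0 ^ n\<close>, which is 0 because
      \<open>n \<ge> 1\<close>; an empty power would be 1.\<close>
    by (rule P.AE_pos_if_cdf_0[OF M_rv]) (use n in \<open>simp add: Fn_eq_cdf[OF n, symmetric] Fn_def F_0\<close>)
  have M_int: "pos_integrable P f (?M n)"
    "pos_expectation P f (?M n) = f 1 + (LINT y:{0<..}|lborel. (indicator {1..} y - Fn n y) * g y)"
    if n: "1 \<le> n" for n
    using f_diff
    by (intro P.pos_expectation_eq_integral[OF M_rv M_pos[OF n] Fn_eq_cdf[OF n] g _ Fn_int[OF n]]; simp)+

  \<comment> \<open>The integral formula of part (a)\<close>
  have diff_eq: "(indicator {1..} y - Fn n y) * g y - (indicator {1..} y - ?G y) * g y = (?G y - Fn n y) * g y" for n y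
    by (simp add: algebra_simps)
  define D where "D = (\<lambda>n. pos_expectation P f (?M n) - pos_expectation Q f Z)"
  \<comment> \<open>Subtracting the two representations cancels \<open>f 1\<close> and the
    indicator, leaving the weight \<open>?G y - Fn n y\<close>.\<close>
  have diff_int: "set_integrable lborel {0<..} (\<lambda>y. (?G y - Fn n y) * g y)"
    and D_eq: "D n = (LINT y:{0<..}|lborel. (?G y - Fn n y) * g y)" if n: "1 \<le> n" for n
    using set_integral_diff[OF Fn_int[OF n] G_int] M_int(2)[OF n] Z_int(2)
    unfolding diff_eq D_def by simp_all

  \<comment> \<open>The explicit bound of part (b)\<close>
  define I where "I = (\<lambda>c. LINT x:{0<..}|lborel. x powr (- (\<alpha> + \<beta>)) * \<bar>g x\<bar> * exp (- c * x powr (- \<alpha>)))"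
  define J where "J = (\<lambda>e. LINT x:{0<..<e}|lborel. exp (- C\<^sub>2 * x powr (- (\<alpha> - \<gamma>))) * \<bar>g x\<bar>)"
  have abs_int: "set_integrable lborel A (\<lambda>x. w x * \<bar>g x\<bar>)"
    if "set_integrable lborel A (\<lambda>x. w x * g x)" "\<And>x. 0 \<le> w x" for A w
    using set_integrable_abs[OF that(1)] that(2) by (simp add: abs_mult)
  have bound: "\<forall>\<^sub>F n in sequentially. \<bar>D n\<bar> \<le> C\<^sub>1 * real n powr (- \<beta> / \<alpha>) * I c + 2 * J (\<epsilon> n)"
    if eps: "\<epsilon> \<longlonglongrightarrow> 0"
      "filterlim (\<lambda>n. real n powr (1 / \<alpha>) * \<epsilon> n) at_top sequentially"
      and c: "0 < c" "c < \<sigma>\<^sub>0 powr \<alpha>" for \<epsilon> c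
  proof -
    have "\<forall>\<^sub>F n in sequentially. \<epsilon> n < 1"
      using eps(1) by (rule order_tendstoD(2)) simp
    with frechet_cdf_diff_bound[OF eps c(2)] eventually_ge_at_top[of 1]
    show ?thesis
    proof eventually_elim
      case (elim n)
      then have n: "1 \<le> n" by simp
      let ?k = "C\<^sub>1 * real n powr (- \<beta> / \<alpha>)"
      let ?v = "\<lambda>x. x powr (- (\<alpha> + \<beta>)) * exp (- c * x powr (- \<alpha>)) * \<bar>g x\<bar>"
      let ?w = "\<lambda>x. exp (- C\<^sub>2 * x powr (- (\<alpha> - \<gamma>))) * \<bar>g x\<bar>"
      \<comment> \<open>The exponent \<open>- (\<alpha> + \<beta>)\<close> is below
        \<open>- \<alpha>\<close>, so the weight is admissible on the whole half-line.\<close>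
      have v_int: "set_integrable lborel {0<..} ?v"
        using c \<alpha> \<beta> by (intro abs_int powr_exp_weight_integrable) auto
      \<comment> \<open>Here \<open>q = 0\<close> exceeds \<open>- \<alpha>\<close>, so the version
        cut at 1 is taken; it suffices because \<open>\<epsilon> n < 1\<close>. For x > 0 the factor
        \<open>x powr 0\<close> is 1.\<close>
      have "set_integrable lborel {0<..<1} (\<lambda>x. x powr 0 * exp (- C\<^sub>2 * x powr (- (\<alpha> - \<gamma>))) * \<bar>g x\<bar>)"
        using C\<^sub>2 \<gamma> by (intro abs_int powr_exp_weight_integrable) auto
      then have "set_integrable lborel {0<..<1} ?w"
        by (rule set_integrable_cong[THEN iffD1, rotated -1]) auto
      then have "set_integrable lborel {0<..<\<epsilon> n} ?w"
        by (rule set_integrable_subset) (use elim in auto)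
      \<comment> \<open>Writing the cut at \<epsilon>(n) as an indicator puts both terms of the
        bound on the same domain.\<close>
      then have w_int: "set_integrable lborel {0<..} (\<lambda>x. indicator {0<..<\<epsilon> n} x * ?w x)"
        unfolding set_integrable_def
        by (simp add: indicator_inter_arith[symmetric] mult.assoc[symmetric] greaterThanLessThan_def)
      have "\<bar>D n\<bar> \<le> (LINT x:{0<..}|lborel. \<bar>(?G x - Fn n x) * g x\<bar>)"
        unfolding D_eq[OF n] set_lebesgue_integral_def
        by (rule order_trans[OF integral_abs_bound]) (simp add: abs_mult)
      also have "\<dots> \<le> (LINT x:{0<..}|lborel. ?k * ?v x + 2 * (indicator {0<..<\<epsilon> n} x * ?w x))"
      proof (rule set_integral_mono)
        fix x :: real assume "x \<in> {0<..}"
        then have "\<bar>?G x - Fn n x\<bar> \<le> ?k * (x powr (- (\<alpha> + \<beta>)) * exp (- c * x powr (- \<alpha>)))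
            + 2 * (indicator {0<..<\<epsilon> n} x * exp (- C\<^sub>2 * x powr (- (\<alpha> - \<gamma>))))"
          using elim by auto
        from mult_right_mono[OF this abs_ge_zero[of "g x"]]
        show "\<bar>(?G x - Fn n x) * g x\<bar> \<le> ?k * ?v x + 2 * (indicator {0<..<\<epsilon> n} x * ?w x)"
          by (simp add: abs_mult distrib_right mult.assoc)
      qed (use set_integrable_abs[OF diff_int[OF n]] v_int w_int in auto)
      also have "\<dots> = ?k * (LINT x:{0<..}|lborel. ?v x) + 2 * (LINT x:{0<..}|lborel. indicator {0<..<\<epsilon> n} x * ?w x)"
        using v_int w_int by simp
      also have "(LINT x:{0<..}|lborel. ?v x) = I c"
        unfolding I_def by (simp add: mult_ac)
      also have "(LINT x:{0<..}|lborel. indicator {0<..<\<epsilon> n} x * ?w x) = J (\<epsilon> n)"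
        unfolding J_def set_lebesgue_integral_def
        by (simp add: indicator_inter_arith[symmetric] mult.assoc[symmetric] greaterThanLessThan_def)
      finally show ?case .
    qed
  qed

  \<comment> \<open>The polynomial rate\<close>
  have rate: "\<exists>C>0. \<forall>\<^sub>F n in sequentially. \<bar>D n\<bar> \<le> C * real n powr (- \<beta> / \<alpha>)"
  proof -
    \<comment> \<open>This \<epsilon>(n) tends to 0, while n^(1/\<alpha>) \<epsilon>(n) =
      n^(1/(2\<alpha>)) still tends to infinity.\<close>
    define \<epsilon> where "\<epsilon> = (\<lambda>n. real n powr (- 1 / (2 * \<alpha>)))"
    let ?w = "\<lambda>x. exp (- C\<^sub>2 * x powr (- (\<alpha> - \<gamma>))) * \<bar>g x\<bar>"
    \<comment> \<open>On \<open>(0,\<epsilon>)\<close> the weight \<open>?w\<close> is at most \<open>\<epsilon>\<^sup>2\<^sup>\<beta>\<close> times \<open>?u\<close>, and \<open>\<epsilon>(n)\<^sup>2\<^sup>\<beta>\<close> is exactly the claimed rate.\<close>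
    let ?u = "\<lambda>x. x powr (- (2 * \<beta>)) * exp (- C\<^sub>2 * x powr (- (\<alpha> - \<gamma>))) * \<bar>g x\<bar>"
    define J' where "J' = (LINT x:{0<..<1}|lborel. ?u x)"
    have u_int: "set_integrable lborel {0<..<1} ?u"
      using C\<^sub>2 \<gamma> by (intro abs_int powr_exp_weight_integrable) auto
    have J_le: "J e \<le> e powr (2 * \<beta>) * J'" if e: "0 < e" "e < 1" for e
    proof -
      have "J e = (LINT x:{0<..<1}|lborel. indicator {0<..<e} x * ?w x)"
        unfolding J_def set_lebesgue_integral_def
        by (rule Bochner_Integration.integral_cong) (use e in \<open>auto simp: indicator_def\<close>)
      also have "\<dots> \<le> (LINT x:{0<..<1}|lborel. e powr (2 * \<beta>) * ?u x)"
        unfolding set_lebesgue_integral_def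
      proof (rule integral_mono')
        show "integrable lborel (\<lambda>x. indicator {0<..<1} x *\<^sub>R (e powr (2 * \<beta>) * ?u x))"
          using set_integrable_mult_right[OF u_int, of "e powr (2 * \<beta>)"] by (simp add: set_integrable_def)
        fix x :: real
        show "indicator {0<..<1} x *\<^sub>R (indicator {0<..<e} x * ?w x)
            \<le> indicator {0<..<1} x *\<^sub>R (e powr (2 * \<beta>) * ?u x)"
        proof (cases "x \<in> {0<..<e}")
          case True
          \<comment> \<open>Since x < e, the factor (e/x)^(2\<beta>) is at least 1.\<close>
          have "1 = x powr (2 * \<beta>) * x powr (- (2 * \<beta>))"
            using True by (simp add: powr_minus)
          also have "\<dots> \<le> e powr (2 * \<beta>) * x powr (- (2 * \<beta>))"
            using True \<beta> by (intro mult_right_mono powr_mono2) auto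
          finally have "1 * ?w x \<le> (e powr (2 * \<beta>) * x powr (- (2 * \<beta>))) * ?w x"
            by (intro mult_right_mono) auto
          then show ?thesis using True e by (simp add: mult.assoc)
        qed (auto simp: indicator_def)
        show "0 \<le> indicator {0<..<1} x *\<^sub>R (e powr (2 * \<beta>) * ?u x)"
          by simp
      qed
      finally show ?thesis by (simp add: J'_def)
    qed
    have eps: "\<epsilon> \<longlonglongrightarrow> 0" "filterlim (\<lambda>n. real n powr (1 / \<alpha>) * \<epsilon> n) at_top sequentially"
      unfolding \<epsilon>_def using \<alpha> by real_asymp+
    \<comment> \<open>Any fixed admissible \<open>c\<close> serves, since \<open>I c\<close> only
      enters the constant.\<close>
    define c where "c = \<sigma>\<^sub>0 powr \<alpha> / 2"
    have c: "0 < c" "c < \<sigma>\<^sub>0 powr \<alpha>" using \<sigma>\<^sub>0 by (simp_all add: c_def)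
    have "\<forall>\<^sub>F n in sequentially. \<bar>D n\<bar> \<le> C\<^sub>1 * real n powr (- \<beta> / \<alpha>) * I c + 2 * J (\<epsilon> n)"
      using eps c by (rule bound)
    moreover have "\<forall>\<^sub>F n in sequentially. \<epsilon> n < 1"
      using eps(1) by (rule order_tendstoD(2)) simp
    \<comment> \<open>The maximum with 1 guarantees a positive constant.\<close>
    ultimately have "\<forall>\<^sub>F n in sequentially. \<bar>D n\<bar> \<le> max 1 (C\<^sub>1 * I c + 2 * J') * real n powr (- \<beta> / \<alpha>)"
      using eventually_ge_at_top[of 1]
    proof eventually_elim
      case (elim n)
      \<comment> \<open>\<open>J_le\<close> asks for \<open>0 < \<epsilon> n\<close>, which holds as
        \<open>n \<ge> 1\<close>; a power with base 0 would be 0.\<close>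
      have "J (\<epsilon> n) \<le> \<epsilon> n powr (2 * \<beta>) * J'"
        using elim by (intro J_le) (simp_all add: \<epsilon>_def)
      also have "\<epsilon> n powr (2 * \<beta>) = real n powr (- \<beta> / \<alpha>)"
        using \<alpha> by (simp add: \<epsilon>_def powr_powr field_simps)
      finally have "\<bar>D n\<bar> \<le> (C\<^sub>1 * I c + 2 * J') * real n powr (- \<beta> / \<alpha>)"
        using elim(1) by (simp add: algebra_simps)
      also have "\<dots> \<le> max 1 (C\<^sub>1 * I c + 2 * J') * real n powr (- \<beta> / \<alpha>)"
        by (rule mult_right_mono) auto
      finally show ?case .
    qed
    then show ?thesis by (intro exI[of _ "max 1 (C\<^sub>1 * I c + 2 * J')"]) auto
  qed

  \<comment> \<open>Return to Lebesgue integrals of \<open>f'\<close>\<close>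
  have I_eq: "(LINT x:{0<..}|lebesgue. x powr (- (\<alpha> + \<beta>)) * \<bar>f' x\<bar> * exp (- c * x powr (- \<alpha>))) = I c" for c
    unfolding I_def by (rule transfer(2)[where \<Phi> = "\<lambda>x y. x powr (- (\<alpha> + \<beta>)) * \<bar>y\<bar> * exp (- c * x powr (- \<alpha>))"]) auto
  have J_eq: "(LINT x:{0<..<e}|lebesgue. exp (- C\<^sub>2 * x powr (- (\<alpha> - \<gamma>))) * \<bar>f' x\<bar>) = J e" for e
    unfolding J_def by (rule transfer(2)[where \<Phi> = "\<lambda>x y. exp (- C\<^sub>2 * x powr (- (\<alpha> - \<gamma>))) * \<bar>y\<bar>"]) auto
  have diff_transfer:
    "set_integrable lebesgue {0<..} (\<lambda>x. (?G x - Fn n x) * f' x)"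
    "D n = (LINT x:{0<..}|lebesgue. (?G x - Fn n x) * f' x)" if n: "1 \<le> n" for n
  proof -
    note [measurable] = Fn_meas[OF n]
    show "set_integrable lebesgue {0<..} (\<lambda>x. (?G x - Fn n x) * f' x)"
      using diff_int[OF n] by (subst transfer(1)[where \<Phi> = "\<lambda>x y. (?G x - Fn n x) * y"]) auto
    show "D n = (LINT x:{0<..}|lebesgue. (?G x - Fn n x) * f' x)"
      using D_eq[OF n] by (subst transfer(2)[where \<Phi> = "\<lambda>x y. (?G x - Fn n x) * y"]) auto
  qed
  show ?thesis
  proof (intro conjI allI impI)
    show "pos_integrable Q f Z" by (rule Z_int(1))
    fix n :: nat assume n: "1 \<le> n"
    show "pos_integrable P f (?M n)" by (rule M_int(1)[OF n])
    show "set_integrable lebesgue {0<..} (\<lambda>x. (?G x - normalized_max_cdf P \<alpha> X n x) * f' x)"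
      unfolding Fn[OF n] by (rule diff_transfer[OF n])
    show "pos_expectation P f (?M n) - pos_expectation Q f Z =
        (LINT x:{0<..}|lebesgue. (?G x - normalized_max_cdf P \<alpha> X n x) * f' x)"
      unfolding Fn[OF n] using diff_transfer(2)[OF n] by (simp add: D_def)
  next
    show "\<exists>C>0. \<forall>\<^sub>F n in sequentially.
        \<bar>pos_expectation P f (?M n) - pos_expectation Q f Z\<bar> \<le> C * real n powr (- \<beta> / \<alpha>)"
      using rate by (simp add: D_def)
  next
    fix \<epsilon> :: "nat \<Rightarrow> real" and c :: real
    assume "(\<forall>n\<ge>1. \<epsilon> n > 0) \<and> \<epsilon> \<longlonglongrightarrow> 0 \<and>
      filterlim (\<lambda>n. real n powr (1 / \<alpha>) * \<epsilon> n) at_top sequentially \<and> 0 < c \<and> c < \<sigma>\<^sub>0 powr \<alpha>"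
    then show "\<forall>\<^sub>F n in sequentially.
         \<bar>pos_expectation P f (?M n) - pos_expectation Q f Z\<bar> \<le>
           C\<^sub>1 * real n powr (- \<beta> / \<alpha>) *
             (LINT x:{0<..}|lebesgue. x powr (- (\<alpha> + \<beta>)) * \<bar>f' x\<bar> * exp (- c * x powr (- \<alpha>)))
           + 2 * (LINT x:{0<..<\<epsilon> n}|lebesgue. exp (- C\<^sub>2 * x powr (- (\<alpha> - \<gamma>))) * \<bar>f' x\<bar>)"
      unfolding I_eq J_eq using bound[of \<epsilon> c] by (simp add: D_def)
  qed
qed

end
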